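(* Let $N\ge3$, $1<p<\frac{N+2}{N-2}$, and set $$K(N,p)=(N-2)^{-\frac{p+1}{2}}\,|\mathbb S^{N-1}|^{\frac{1-p}{2}}\,\Gamma\!\left(N-\frac{(p+1)(N-2)}{2}\right),$$ where $|\mathbb S^{N-1}|=2\pi^{N/2}/\Gamma(N/2)$. Let $R\in[0,1)$ satisfy $$R^{\frac{2N}{p+1}-(N-2)}\min\left\{e^{\frac{4}{R(p+1)}},e^{\frac{4}{(1-R)(p+1)}}\right\}<K(N,p)^{-\frac{2}{p+1}}S^{-1}$$ (with the convention $e^{4/(R(p+1))}=+\infty$ when $R=0$). Then there exists $\alpha(R)>0$ such that for all $\alpha>\alpha(R)$ one has $S_\alpha<S_{\alpha,\mathrm{rad}}$, and no groundstate of $(\mathcal P)$ is radially symmetric.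
   Context: Let $B=B(0,1)\subset\mathbb R^N$. For $\alpha>0$ and $R\in(0,1)$ define the radial weight $V=V_{R,\alpha}$ by $V(r)=(1-r/R)^\alpha$ for $0\le r<R$ and $V(r)=\left(1-\frac{1-r}{1-R}\right)^\alpha$ for $R\le r\le 1$; for $R=0$ set $V(|x|)=|x|^\alpha$ and for $R=1$ set $V(|x|)=(1-|x|)^\alpha$. Problem $(\mathcal P)$: $-\Delta u=V(|x|)|u|^{p-1}u$ in $B$, $u=0$ on $\partial B$. $S_{\alpha}=\inf_{0\ne u\in H^1_0(B)}\frac{\int_B|Du|^2}{(\int_B V|u|^{p+1})^{2/(p+1)}}$ and $S_{\alpha,\mathrm{rad}}$ is the same infimum over radial functions $0\ne u\in H^1_{0,\mathrm{rad}}(B)$. $S=\inf_{0\ne u\in H^1_0(B)}\frac{\int_B|Du|^2}{(\int_B|u|^{p+1})^{2/(p+1)}}$ is the best constant of the embedding $H^1_0(B)\subset L^{p+1}(B)$. A groundstate of $(\mathcal P)$ is $u_\alpha=S_\alpha^{1/(p-1)}u^*_\alpha$ with $u^*_\alpha$ a positive minimiser of $S_\alpha$ normalised by $\int_BV|u^*_\alpha|^{p+1}=1$ (a positive least-energy solution). *)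

theory Defs
  imports "HOL-Analysis.Analysis"
begin

definition partial_deriv :: "'n::finite \<Rightarrow> (real^'n \<Rightarrow> real) \<Rightarrow> real^'n \<Rightarrow> real" where
  "partial_deriv i f x = frechet_derivative f (at x) (axis i 1)"

definition grad :: "(real^'n::finite \<Rightarrow> real) \<Rightarrow> real^'n \<Rightarrow> real^'n" where
  "grad f x = (\<chi> i. partial_deriv i f x)"

fun Ck_fun :: "nat \<Rightarrow> (real^'n::finite \<Rightarrow> real) \<Rightarrow> bool" where
  "Ck_fun 0 f = continuous_on UNIV f"
| "Ck_fun (Suc k) f = ((\<forall>x. f differentiable (at x)) \<and> (\<forall>i. Ck_fun k (partial_deriv i f)))"

definition smooth_fun :: "(real^'n::finite \<Rightarrow> real) \<Rightarrow> bool" where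
  "smooth_fun f = (\<forall>k. Ck_fun k f)"

definition unit_ball :: "(real^'n::finite) set" where
  "unit_ball = ball 0 1"

definition test_fun :: "(real^'n::finite \<Rightarrow> real) \<Rightarrow> bool" where
  "test_fun \<phi> = (smooth_fun \<phi> \<and> compact (closure {x. \<phi> x \<noteq> 0})
                   \<and> closure {x. \<phi> x \<noteq> 0} \<subseteq> unit_ball)"

text \<open>H10 u g: u belongs to H^1_0(B) and g is its (weak) gradient Du.\<close>
definition H10 :: "(real^'n::finite \<Rightarrow> real) \<Rightarrow> (real^'n \<Rightarrow> real^'n) \<Rightarrow> bool" where
  "H10 u g = (u \<in> borel_measurable lebesgue \<and> g \<in> borel_measurable lebesgue \<and>
     (\<exists>\<phi> :: nat \<Rightarrow> real^'n \<Rightarrow> real. (\<forall>k. test_fun (\<phi> k)) \<and>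
        (\<lambda>k. \<integral>\<^sup>+ x. ennreal ((\<phi> k x - u x)\<^sup>2) \<partial>lebesgue) \<longlonglongrightarrow> 0 \<and>
        (\<lambda>k. \<integral>\<^sup>+ x. ennreal ((norm (grad (\<phi> k) x - g x))\<^sup>2) \<partial>lebesgue) \<longlonglongrightarrow> 0))"

definition nonzero_fun :: "(real^'n::finite \<Rightarrow> real) \<Rightarrow> bool" where
  "nonzero_fun u = (\<not> (AE x in lebesgue. u x = 0))"

definition radial_fun :: "(real^'n::finite \<Rightarrow> real) \<Rightarrow> bool" where
  "radial_fun u = (\<exists>f :: real \<Rightarrow> real. AE x in lebesgue. u x = f (norm x))"

definition Vw :: "real \<Rightarrow> real \<Rightarrow> real \<Rightarrow> real" where
  "Vw R \<alpha> r =
    (if R = 0 then r powr \<alpha>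
     else if R = 1 then (1 - r) powr \<alpha>
     else if r < R then (1 - r / R) powr \<alpha>
     else (1 - (1 - r) / (1 - R)) powr \<alpha>)"

definition rayleigh :: "(real \<Rightarrow> real) \<Rightarrow> real \<Rightarrow> (real^'n::finite \<Rightarrow> real) \<Rightarrow> (real^'n \<Rightarrow> real^'n) \<Rightarrow> real" where
  "rayleigh W p u g =
     (\<integral>x\<in>unit_ball. (norm (g x))\<^sup>2 \<partial>lebesgue) /
     ((\<integral>x\<in>unit_ball. W (norm x) * \<bar>u x\<bar> powr (p + 1) \<partial>lebesgue) powr (2 / (p + 1)))"

definition S_alpha :: "'n::finite itself \<Rightarrow> real \<Rightarrow> real \<Rightarrow> real \<Rightarrow> real" where
  "S_alpha _ p R \<alpha> = (INF ug \<in> {(u :: real^'n \<Rightarrow> real, g). H10 u g \<and> nonzero_fun u}.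
                        rayleigh (Vw R \<alpha>) p (fst ug) (snd ug))"

definition S_alpha_rad :: "'n::finite itself \<Rightarrow> real \<Rightarrow> real \<Rightarrow> real \<Rightarrow> real" where
  "S_alpha_rad _ p R \<alpha> = (INF ug \<in> {(u :: real^'n \<Rightarrow> real, g). H10 u g \<and> nonzero_fun u \<and> radial_fun u}.
                        rayleigh (Vw R \<alpha>) p (fst ug) (snd ug))"

definition S_sob :: "'n::finite itself \<Rightarrow> real \<Rightarrow> real" where
  "S_sob _ p = (INF ug \<in> {(u :: real^'n \<Rightarrow> real, g). H10 u g \<and> nonzero_fun u}.
                        rayleigh (\<lambda>_. 1) p (fst ug) (snd ug))"

definition groundstate :: "real \<Rightarrow> real \<Rightarrow> real \<Rightarrow> (real^'n::finite \<Rightarrow> real) \<Rightarrow> bool" where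
  "groundstate p R \<alpha> u =
     (\<exists>ustar g. H10 ustar g \<and> (AE x in lebesgue. x \<in> unit_ball \<longrightarrow> ustar x > 0) \<and>
        (\<integral>x\<in>unit_ball. Vw R \<alpha> (norm x) * \<bar>ustar x\<bar> powr (p + 1) \<partial>lebesgue) = 1 \<and>
        rayleigh (Vw R \<alpha>) p ustar g = S_alpha TYPE('n) p R \<alpha> \<and>
        u = (\<lambda>x. S_alpha TYPE('n) p R \<alpha> powr (1 / (p - 1)) * ustar x))"

definition sphere_area :: "nat \<Rightarrow> real" where
  "sphere_area N = 2 * pi powr (real N / 2) / Gamma (real N / 2)"

definition K_const :: "nat \<Rightarrow> real \<Rightarrow> real" where
  "K_const N p = (real N - 2) powr (- (p + 1) / 2) * sphere_area N powr ((1 - p) / 2)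
                 * Gamma (real N - (p + 1) * (real N - 2) / 2)"

end

theory Submission
  imports Defs
begin

text \<open>
  Concentrating a near-minimiser of \<^term>\<open>S_sob\<close> on a ball of radius 1/\<alpha>, centred at the origin or
  touching the boundary from inside, where the weight stays above a fixed constant, bounds
  S_\<alpha> by a constant times \<alpha> to the power 2N/(p+1) - (N-2). A radial function instead
  obeys the pointwise bound |u(x)|^2 \<le> ||Du||^2 (|x|^(2-N) - 1) / ((N-2) |S^(N-1)|);
  integrating it against the weight gives a lower bound for the radial infimum of the same order
  in \<alpha>, whose leading constant is the Gamma integral appearing in K(N,p). The hypothesis on R
  compares the two constants.

  The hypothesis also forces \<^term>\<open>S_sob\<close> to be positive, since x / 0 = 0. Hence no quotient
  \<^term>\<open>rayleigh (\<lambda>_. 1) p u g\<close> can vanish, and all integrals in it converge: no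
  Sobolev inequality has to be proved.
\<close>

section \<open>Smooth functions and test functions\<close>

text \<open>Write q = (p+1)/2, t = 2/(p+1) and a = N - q(N-2). Then a t is the exponent of R in the
  hypothesis, a is the argument of Gamma in \<open>K_const\<close>, and subcriticality of p means a
  > 0. For s < R the weight is at most exp(-\<alpha> s/R), and the q-th power of the bound on |u|^2
  times s^(N-1) is at most a constant times s^(a-1); this yields Gamma(a) (R/\<alpha>)^a. For s >= R
  the bound on |u|^2 vanishes linearly at s = 1, so this zone contributes only order
  \<alpha>^(-(q+1)), which is smaller because a < 2 < q+1. The obstacle in the radial bound is that
  u is merely an L2 limit of test functions that need not be radial, so no pointwise inequality is
  available to pass to the limit. The ray estimate is therefore kept as an inequality between
  integrals over sets of points with |x| in C. It holds for every test function and survives the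
  limit; radiality of u enters only when C is taken from the set where the pointwise bound
  fails.\<close>

lemma partial_deriv_eqI:
  assumes "(f has_derivative f') (at x)"
  shows "partial_deriv i f x = f' (axis i 1)"
  unfolding partial_deriv_def using frechet_derivative_at[OF assms] by simp

lemma has_derivative_grad:
  fixes f :: "real^'n::finite \<Rightarrow> real"
  assumes "f differentiable (at x)"
  shows "(f has_derivative (\<lambda>h. grad f x \<bullet> h)) (at x)"
proof -
  let ?D = "frechet_derivative f (at x)"
  have D: "(f has_derivative ?D) (at x)"
    using assms by (simp add: frechet_derivative_works)
  have lin: "linear ?D"
    using D has_derivative_linear by blast
  have "?D h = grad f x \<bullet> h" for h
  proof -
    have "?D h = ?D (\<Sum>i\<in>UNIV. h $ i *\<^sub>R axis i 1)"
      using basis_expansion[of h] by (simp add: scalar_mult_eq_scaleR)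
    also have "\<dots> = (\<Sum>i\<in>UNIV. h $ i * ?D (axis i 1))"
      by (simp add: linear_sum[OF lin] linear_scale[OF lin])
    also have "\<dots> = grad f x \<bullet> h"
      by (simp add: inner_vec_def grad_def partial_deriv_def mult.commute)
    finally show ?thesis .
  qed
  then have "?D = (\<lambda>h. grad f x \<bullet> h)" by auto
  with D show ?thesis by simp
qed

lemma smooth_fun_differentiable: "smooth_fun f \<Longrightarrow> f differentiable (at x)"
  unfolding smooth_fun_def by (metis Ck_fun.simps(2))

lemma smooth_fun_continuous: "smooth_fun f \<Longrightarrow> continuous_on UNIV f"
  unfolding smooth_fun_def by (metis Ck_fun.simps(1))

lemma smooth_fun_continuous_grad:
  assumes "smooth_fun f" shows "continuous_on UNIV (grad f)"
proof -
  have "Ck_fun (Suc 0) f" using assms by (simp only: smooth_fun_def)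
  then show ?thesis
    unfolding grad_def by (intro continuous_on_vec_lambda) simp
qed

lemma Ck_fun_add:
  "Ck_fun k f \<Longrightarrow> Ck_fun k g \<Longrightarrow> Ck_fun k (\<lambda>x. f x + g x)"
proof (induction k arbitrary: f g)
  case 0
  then show ?case by (auto intro: continuous_on_add)
next
  case (Suc k)
  have "partial_deriv i (\<lambda>x. f x + g x) = (\<lambda>x. partial_deriv i f x + partial_deriv i g x)" for i
  proof
    fix x
    have "((\<lambda>x. f x + g x) has_derivative (\<lambda>h. grad f x \<bullet> h + grad g x \<bullet> h)) (at x)"
      using Suc.prems by (auto intro!: has_derivative_add has_derivative_grad)
    from partial_deriv_eqI[OF this, of i] show "partial_deriv i (\<lambda>x. f x + g x) x = partial_deriv i f x + partial_deriv i g x"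
      by (simp add: grad_def inner_axis)
  qed
  with Suc show ?case by (auto intro!: Suc.IH)
qed

lemma partial_deriv_affine:
  fixes f :: "real^'n::finite \<Rightarrow> real"
  assumes "\<And>x. f differentiable (at x)"
  shows "(\<lambda>x. d * f (b + a *\<^sub>R x)) differentiable (at x)"
    and "partial_deriv i (\<lambda>x. d * f (b + a *\<^sub>R x)) x = (d * a) * partial_deriv i f (b + a *\<^sub>R x)"
proof -
  have "((\<lambda>x. b + a *\<^sub>R x) has_derivative (\<lambda>h. a *\<^sub>R h)) (at x)"
    by (auto intro!: derivative_eq_intros)
  from diff_chain_at[OF this has_derivative_grad[OF assms]]
  have "((\<lambda>x. f (b + a *\<^sub>R x)) has_derivative (\<lambda>h. grad f (b + a *\<^sub>R x) \<bullet> (a *\<^sub>R h))) (at x)"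
    by (simp add: o_def)
  then have D: "((\<lambda>x. d * f (b + a *\<^sub>R x)) has_derivative
      (\<lambda>h. d * (grad f (b + a *\<^sub>R x) \<bullet> (a *\<^sub>R h)))) (at x)"
    by (rule has_derivative_mult_right)
  then show "(\<lambda>x. d * f (b + a *\<^sub>R x)) differentiable (at x)"
    by (auto simp: differentiable_def)
  show "partial_deriv i (\<lambda>x. d * f (b + a *\<^sub>R x)) x = (d * a) * partial_deriv i f (b + a *\<^sub>R x)"
    using partial_deriv_eqI[OF D, of i] by (simp add: grad_def inner_axis)
qed

text \<open>The factor d makes the class closed under partial differentiation: d turns into d * a
  and f into its partial derivative, so the induction on the order goes through.\<close>

lemma Ck_fun_affine:
  "Ck_fun k f \<Longrightarrow> Ck_fun k (\<lambda>x. d * f (b + a *\<^sub>R x))"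
proof (induction k arbitrary: f d)
  case 0
  then have "continuous_on UNIV f" by simp
  then have "continuous_on UNIV (\<lambda>x. f (b + a *\<^sub>R x))"
    by (rule continuous_on_compose2) (auto intro!: continuous_intros)
  then show ?case by (auto intro!: continuous_intros)
next
  case (Suc k)
  then have diff: "\<And>x. f differentiable (at x)" by auto
  have "partial_deriv i (\<lambda>x. d * f (b + a *\<^sub>R x)) = (\<lambda>x. (d * a) * partial_deriv i f (b + a *\<^sub>R x))" for i
    using partial_deriv_affine(2)[OF diff] by auto
  with Suc partial_deriv_affine(1)[OF diff] show ?case
    by auto
qed

subsection \<open>A radial test function\<close>

text \<open>For k = 0 this is the classical flat function. The denominators t ^ k make the family
  closed under differentiation up to linear combinations.\<close>

definition bump_profile :: "nat \<Rightarrow> real \<Rightarrow> real" where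
  "bump_profile k t = (if t > 0 then exp (- 1 / t) / t ^ k else 0)"

text \<open>A single term of the exponential series at 1/t, of index k + 2, already dominates. Two
  powers of t are left over, enough to force derivative 0 at t = 0.\<close>

lemma bump_profile_bound: "\<bar>bump_profile k t\<bar> \<le> fact (k + 2) * t\<^sup>2"
proof (cases "t > 0")
  case True
  have "(1/t) ^ (k+2) / fact (k+2) \<le> exp (1/t)"
  proof -
    have "(\<Sum>n\<in>{k+2}. inverse (fact n) *\<^sub>R (1/t) ^ n) \<le> (\<Sum>n. inverse (fact n) *\<^sub>R (1/t) ^ n)"
      using True by (intro sum_le_suminf summable_exp_generic) auto
    then show ?thesis by (simp add: exp_def field_simps)
  qed
  then have "exp (- 1/t) \<le> fact (k+2) * t ^ (k+2)"
    using True unfolding exp_minus[of "1/t"] minus_divide_left[symmetric]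
    by (simp add: power_divide divide_simps mult.commute del: fact_Suc power_Suc add_2_eq_Suc')
  then show ?thesis
    using True
    by (simp add: bump_profile_def divide_le_eq power_add power2_eq_square mult_ac del: fact_Suc add_2_eq_Suc')
qed (auto simp: bump_profile_def)

lemma has_derivative_bump_profile:
  "(bump_profile k has_real_derivative bump_profile (k+2) t - real k * bump_profile (k+1) t) (at t)"
proof -
  consider "t > 0" | "t < 0" | "t = 0" by linarith
  then show ?thesis
  proof cases
    case 1
    have p: "t ^ m = t * t ^ (m - Suc 0)" if "m \<noteq> 0" for m
      using that by (cases m) auto
    have "((\<lambda>t. exp (- 1 / t) / t ^ k) has_real_derivative bump_profile (k+2) t - real k * bump_profile (k+1) t) (at t)"
      using 1 by (cases k) (auto intro!: derivative_eq_intros p simp: bump_profile_def field_simps power2_eq_square)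
    moreover have "\<forall>\<^sub>F x in nhds t. exp (- 1 / x) / x ^ k = bump_profile k x"
      using eventually_nhds_in_open[of "{0<..}" t] 1
      by (auto elim!: eventually_mono simp: bump_profile_def)
    ultimately show ?thesis by (subst DERIV_cong_ev[OF refl _ refl]) (auto simp: eq_commute)
  next
    case 2
    have "\<forall>\<^sub>F x in nhds t. bump_profile k x = 0"
      using eventually_nhds_in_open[of "{..<0}" t] 2
      by (auto elim!: eventually_mono simp: bump_profile_def)
    then show ?thesis using 2
      by (subst DERIV_cong_ev[OF refl _ refl, where g="\<lambda>_. 0"]) (auto simp: bump_profile_def)
  next
    case 3
    have "((\<lambda>h. (bump_profile k (0 + h) - bump_profile k 0) / h) \<longlongrightarrow> 0) (at 0)"
    proof (rule Lim_null_comparison)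
      show "\<forall>\<^sub>F h in at 0. norm ((bump_profile k (0 + h) - bump_profile k 0) / h) \<le> fact (k+2) * \<bar>h\<bar>"
      proof (rule always_eventually, rule allI)
        fix h :: real
        show "norm ((bump_profile k (0 + h) - bump_profile k 0) / h) \<le> fact (k+2) * \<bar>h\<bar>"
        proof (cases "h = 0")
          case False
          have "\<bar>bump_profile k h\<bar> \<le> (fact (k+2) * \<bar>h\<bar>) * \<bar>h\<bar>"
            using bump_profile_bound[of k h] by (simp add: power2_eq_square)
          with False show ?thesis by (simp add: bump_profile_def divide_le_eq)
        qed auto
      qed
      show "((\<lambda>h. fact (k+2) * \<bar>h\<bar>) \<longlongrightarrow> 0) (at (0::real))"
        by (auto intro!: tendsto_eq_intros)
    qed
    with 3 show ?thesis by (simp add: DERIV_def bump_profile_def)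
  qed
qed

lemma real_polynomial_function_partial_deriv:
  fixes q :: "real^'n::finite \<Rightarrow> real"
  assumes "real_polynomial_function q"
  shows "(\<forall>x. q differentiable (at x)) \<and> real_polynomial_function (partial_deriv i q)"
  using assms
proof induction
  case (linear f)
  have d: "(f has_derivative f) (at x)" for x
    using linear by (rule bounded_linear_imp_has_derivative)
  have "partial_deriv i f = (\<lambda>x. f (axis i 1))"
    using partial_deriv_eqI[OF d] by auto
  then show ?case using d by (auto simp: differentiable_def)
next
  case (const c)
  have d: "((\<lambda>_. c) has_derivative (\<lambda>_. 0)) (at x)" for x :: "real^'n"
    by (rule has_derivative_const)
  have "partial_deriv i (\<lambda>x::real^'n. c) = (\<lambda>x. 0)"
    using partial_deriv_eqI[OF d] by auto
  then show ?case by auto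
next
  case (add f g)
  have d: "((\<lambda>x. f x + g x) has_derivative (\<lambda>h. grad f x \<bullet> h + grad g x \<bullet> h)) (at x)" for x
    using add by (auto intro!: has_derivative_add has_derivative_grad)
  have "partial_deriv i (\<lambda>x. f x + g x) = (\<lambda>x. partial_deriv i f x + partial_deriv i g x)"
    using partial_deriv_eqI[OF d] by (auto simp: grad_def inner_axis)
  then show ?case using add d by (auto simp: differentiable_def)
next
  case (mult f g)
  have d: "((\<lambda>x. f x * g x) has_derivative (\<lambda>h. f x * (grad g x \<bullet> h) + (grad f x \<bullet> h) * g x)) (at x)" for x
    using mult by (auto intro!: has_derivative_mult has_derivative_grad)
  have "partial_deriv i (\<lambda>x. f x * g x) = (\<lambda>x. f x * partial_deriv i g x + partial_deriv i f x * g x)"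
    using partial_deriv_eqI[OF d] by (auto simp: grad_def inner_axis)
  then show ?case using mult d by (auto simp: differentiable_def)
qed

text \<open>Differentiating 1/4 - x \<bullet> x produces linear factors and shifts k, so polynomials
  times bump profiles form a class closed under partial derivatives. Hence the induction is general
  in both q and k.\<close>

lemma Ck_fun_poly_bump:
  fixes q :: "real^'n::finite \<Rightarrow> real"
  assumes "real_polynomial_function q"
  shows "Ck_fun n (\<lambda>x. q x * bump_profile k (1/4 - x \<bullet> x))"
  using assms
proof (induction n arbitrary: q k)
  case 0
  have "continuous_on UNIV (bump_profile k)"
    by (meson has_derivative_bump_profile DERIV_isCont continuous_at_imp_continuous_on)
  then have "continuous_on UNIV (\<lambda>x::real^'n. bump_profile k (1/4 - x \<bullet> x))"
    by (rule continuous_on_compose2) (auto intro!: continuous_intros)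
  moreover have "continuous_on UNIV q"
    using 0 continuous_on_polymonial_function by (simp add: real_polynomial_function_eq)
  ultimately show ?case by (auto intro!: continuous_intros)
next
  case (Suc n)
  let ?b = "\<lambda>k (x::real^'n). bump_profile k (1/4 - x \<bullet> x)"
  note q = real_polynomial_function_partial_deriv[OF Suc.prems]
  have db: "(?b k has_derivative (\<lambda>h. (- 2 * (x \<bullet> h)) * (?b (k+2) x - real k * ?b (k+1) x))) (at x)" for x
  proof -
    have "((\<lambda>x::real^'n. 1/4 - x \<bullet> x) has_derivative (\<lambda>h. - 2 * (x \<bullet> h))) (at x)"
      by (auto intro!: derivative_eq_intros simp: inner_commute)
    from diff_chain_at[OF this has_derivative_bump_profile[unfolded has_field_derivative_def]]
    show ?thesis by (simp add: o_def mult.commute)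
  qed
  have d: "((\<lambda>x. q x * ?b k x) has_derivative (\<lambda>h. q x * ((- 2 * (x \<bullet> h)) * (?b (k+2) x - real k * ?b (k+1) x))
       + (grad q x \<bullet> h) * ?b k x)) (at x)" for x
    using q db by (intro has_derivative_mult has_derivative_grad) auto
  have pd: "partial_deriv i (\<lambda>x. q x * ?b k x) =
     (\<lambda>x. ((q x * (- 2 * x $ i)) * ?b (k+2) x + (q x * (2 * real k * x $ i)) * ?b (k+1) x) + partial_deriv i q x * ?b k x)" for i
    using partial_deriv_eqI[OF d] by (auto simp: grad_def inner_axis algebra_simps)
  have lin: "real_polynomial_function (\<lambda>x::real^'n. x $ i)" for i
    by (intro real_polynomial_function.intros(1) bounded_linear_vec_nth)
  have "Ck_fun n (partial_deriv i (\<lambda>x. q x * ?b k x))" for i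
    unfolding pd using Suc.prems lin q
    by (intro Ck_fun_add Suc.IH real_polynomial_function.intros(4)) auto
  then show ?case using d by (auto simp: differentiable_def)
qed

text \<open>The support is the closed ball of radius 1/2. This function serves as a witness that the
  index sets of \<open>S_sob\<close> and \<open>S_alpha_rad\<close> are nonempty, without which the
  real infimum says nothing.\<close>

definition radial_bump :: "real^'n::finite \<Rightarrow> real" where
  "radial_bump x = bump_profile 0 (1/4 - x \<bullet> x)"

lemma radial_bump_pos_iff: "radial_bump x \<noteq> 0 \<longleftrightarrow> norm x < 1/2"
proof -
  have "x \<bullet> x < (1/2)\<^sup>2 \<longleftrightarrow> norm x < 1/2"
    by (metis norm_ge_zero power2_norm_eq_inner power_less_imp_less_base power_strict_mono half_gt_zero_iff less_le pos2 zero_less_one)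
  then show ?thesis
    by (auto simp: radial_bump_def bump_profile_def power2_eq_square)
qed

lemma test_fun_radial_bump: "test_fun radial_bump"
proof -
  have "smooth_fun (radial_bump :: real^'n \<Rightarrow> real)"
    unfolding smooth_fun_def
  proof
    fix k
    show "Ck_fun k (radial_bump :: real^'n \<Rightarrow> real)"
      using Ck_fun_poly_bump[of "\<lambda>_::real^'n. 1" k 0, OF real_polynomial_function.intros(2)]
      by (simp add: radial_bump_def[abs_def])
  qed
  moreover have supp: "{x::real^'n. radial_bump x \<noteq> 0} = ball 0 (1/2)"
    by (auto simp: radial_bump_pos_iff)
  moreover have "closure (ball (0::real^'n) (1/2)) = cball 0 (1/2)"
    by (rule closure_ball) simp
  ultimately show ?thesis
    unfolding test_fun_def unit_ball_def supp by auto
qed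

lemma borel_measurable_test_fun:
  assumes "test_fun \<phi>"
  shows "\<phi> \<in> borel_measurable borel" "grad \<phi> \<in> borel_measurable borel"
  using assms smooth_fun_continuous smooth_fun_continuous_grad
  by (auto simp: test_fun_def intro: borel_measurable_continuous_onI)

lemma H10_test_fun:
  assumes "test_fun \<phi>" shows "H10 \<phi> (grad \<phi>)"
  unfolding H10_def
  using assms borel_measurable_test_fun[OF assms]
  by (auto intro!: exI[of _ "\<lambda>_. \<phi>"] measurable_completion)

lemma nonzero_radial_bump: "nonzero_fun (radial_bump :: real^'n::finite \<Rightarrow> real)"
proof -
  have "\<not> (AE x in lebesgue. radial_bump (x::real^'n) = 0)"
  proof
    assume "AE x in lebesgue. radial_bump (x::real^'n) = 0"
    then have "negligible {x::real^'n. radial_bump x \<noteq> 0}"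
      unfolding eventually_ae_filter_negligible using negligible_subset by blast
    moreover have "{x::real^'n. radial_bump x \<noteq> 0} = ball 0 (1/2)"
      by (auto simp: radial_bump_pos_iff)
    ultimately show False
      using open_not_negligible[of "ball (0::real^'n) (1/2)"] by auto
  qed
  then show ?thesis by (simp add: nonzero_fun_def)
qed

lemma radial_radial_bump: "radial_fun radial_bump"
  unfolding radial_fun_def
  by (intro exI[of _ "\<lambda>r. bump_profile 0 (1/4 - r\<^sup>2)"])
     (auto simp: radial_bump_def power2_norm_eq_inner)

section \<open>Affine rescaling\<close>

lemma measurable_lebesgue_affine:
  fixes t :: "'a::euclidean_space"
  assumes "c \<noteq> 0" shows "(\<lambda>x. t + c *\<^sub>R x) \<in> lebesgue \<rightarrow>\<^sub>M lebesgue"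
  using lebesgue_affine_measurable[of "\<lambda>_::'a. c" t] assms
  unfolding scaleR_scaleR[symmetric] scaleR_sum_right[symmetric] euclidean_representation by simp

lemma nn_integral_lebesgue_affine:
  fixes t :: "'a::euclidean_space"
  assumes f: "f \<in> borel_measurable lebesgue" and c: "c \<noteq> 0"
  shows "(\<integral>\<^sup>+x. f x \<partial>lebesgue) = ennreal (\<bar>c\<bar> ^ DIM('a)) * (\<integral>\<^sup>+x. f (t + c *\<^sub>R x) \<partial>lebesgue)"
proof -
  let ?T = "\<lambda>x::'a. t + c *\<^sub>R x"
  have "lebesgue = density (distr lebesgue lebesgue ?T) (\<lambda>_. ennreal (\<bar>c\<bar> ^ DIM('a)))"
    using lebesgue_affine_euclidean[where c="\<lambda>_::'a. c" and t=t] c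
    unfolding scaleR_scaleR[symmetric] scaleR_sum_right[symmetric] euclidean_representation prod_constant by simp
  then have "(\<integral>\<^sup>+x. f x \<partial>lebesgue) = (\<integral>\<^sup>+x. f x \<partial>density (distr lebesgue lebesgue ?T) (\<lambda>_. ennreal (\<bar>c\<bar> ^ DIM('a))))"
    by simp
  also have "\<dots> = (\<integral>\<^sup>+x. ennreal (\<bar>c\<bar> ^ DIM('a)) * f x \<partial>distr lebesgue lebesgue ?T)"
    using f by (subst nn_integral_density) auto
  also have "\<dots> = (\<integral>\<^sup>+x. ennreal (\<bar>c\<bar> ^ DIM('a)) * f (?T x) \<partial>lebesgue)"
    using f measurable_lebesgue_affine[OF c] by (subst nn_integral_distr) auto
  also have "\<dots> = ennreal (\<bar>c\<bar> ^ DIM('a)) * (\<integral>\<^sup>+x. f (?T x) \<partial>lebesgue)"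
    using measurable_compose[OF measurable_lebesgue_affine[OF c] f] by (intro nn_integral_cmult) auto
  finally show ?thesis .
qed

lemma integral_lebesgue_affine:
  fixes t :: "'a::euclidean_space" and f :: "'a \<Rightarrow> real"
  assumes f: "f \<in> borel_measurable lebesgue" and c: "c \<noteq> 0" and nn: "\<And>x. 0 \<le> f x"
  shows "(\<integral>x. f x \<partial>lebesgue) = \<bar>c\<bar> ^ DIM('a) * (\<integral>x. f (t + c *\<^sub>R x) \<partial>lebesgue)"
proof -
  have m: "(\<lambda>x. f (t + c *\<^sub>R x)) \<in> borel_measurable lebesgue"
    using measurable_compose[OF measurable_lebesgue_affine[OF c] f] .
  have "(\<integral>\<^sup>+x. ennreal (f x) \<partial>lebesgue) = ennreal (\<bar>c\<bar> ^ DIM('a)) * (\<integral>\<^sup>+x. ennreal (f (t + c *\<^sub>R x)) \<partial>lebesgue)"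
    using f c by (intro nn_integral_lebesgue_affine) auto
  then show ?thesis
    using f m nn by (simp add: integral_eq_nn_integral enn2real_mult)
qed

lemma integrable_lebesgue_affine:
  fixes t :: "'a::euclidean_space" and f :: "'a \<Rightarrow> real"
  assumes f: "integrable lebesgue f" and c: "c \<noteq> 0"
  shows "integrable lebesgue (\<lambda>x. f (t + c *\<^sub>R x))"
proof -
  have fm: "f \<in> borel_measurable lebesgue" using f by auto
  have m: "(\<lambda>x. f (t + c *\<^sub>R x)) \<in> borel_measurable lebesgue"
    using measurable_compose[OF measurable_lebesgue_affine[OF c] fm] .
  have "(\<integral>\<^sup>+x. ennreal (norm (f x)) \<partial>lebesgue)
      = ennreal (\<bar>c\<bar> ^ DIM('a)) * (\<integral>\<^sup>+x. ennreal (norm (f (t + c *\<^sub>R x))) \<partial>lebesgue)"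
    using fm c by (intro nn_integral_lebesgue_affine) auto
  moreover have "(\<integral>\<^sup>+x. ennreal (norm (f x)) \<partial>lebesgue) < \<infinity>"
    using f by (simp add: integrable_iff_bounded)
  moreover have pos: "ennreal (\<bar>c\<bar> ^ DIM('a)) \<noteq> 0"
    using c by (simp add: ennreal_eq_0_iff not_le)
  ultimately have "(\<integral>\<^sup>+x. ennreal (norm (f (t + c *\<^sub>R x))) \<partial>lebesgue) < \<infinity>"
    using pos by (metis ennreal_mult_less_top ennreal_zero_less_top infinity_ennreal_def)
  with m show ?thesis by (simp add: integrable_iff_bounded)
qed

section \<open>Vanishing outside the unit ball, and stability of \<open>H10\<close> under affine
  maps\<close>

lemma test_fun_outside:
  assumes "test_fun \<phi>" "x \<notin> unit_ball"
  shows "\<phi> x = 0" "grad \<phi> x = 0"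
proof -
  let ?C = "closure {x. \<phi> x \<noteq> 0}"
  have x: "x \<in> - ?C" using assms by (auto simp: test_fun_def)
  have z: "\<phi> y = 0" if "y \<in> - ?C" for y
    using that closure_subset[of "{x. \<phi> x \<noteq> 0}"] by auto
  show "\<phi> x = 0" using x z by blast
  have "((\<lambda>_. 0::real) has_derivative (\<lambda>_. 0)) (at x)" by simp
  then have "(\<phi> has_derivative (\<lambda>_. 0)) (at x)"
  proof (rule has_derivative_transform_within_open)
    show "open (- ?C)" by (intro open_Compl closed_closure)
    show "x \<in> - ?C" by (rule x)
    show "0 = \<phi> y" if "y \<in> - ?C" for y using z[OF that] by simp
  qed
  from partial_deriv_eqI[OF this] show "grad \<phi> x = 0"
    by (simp add: grad_def vec_eq_iff)
qed

lemma AE_zero_of_nn_integral_tendsto_0: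
  fixes h :: "'a \<Rightarrow> real"
  assumes h: "h \<in> borel_measurable M" and S: "S \<in> sets M"
    and le: "\<And>k x. x \<in> S \<Longrightarrow> h x \<le> f k x" and lim: "(\<lambda>k. \<integral>\<^sup>+x. ennreal (f k x) \<partial>M) \<longlonglongrightarrow> 0"
  shows "AE x in M. x \<in> S \<longrightarrow> h x \<le> 0"
proof -
  have "(\<integral>\<^sup>+x. ennreal (h x) * indicator S x \<partial>M) \<le> (\<integral>\<^sup>+x. ennreal (f k x) \<partial>M)" for k
    using le[of _ k] by (intro nn_integral_mono) (auto split: split_indicator intro: ennreal_leI)
  then have "(\<integral>\<^sup>+x. ennreal (h x) * indicator S x \<partial>M) \<le> 0"
    using LIMSEQ_le_const[OF lim] by auto
  then have "AE x in M. ennreal (h x) * indicator S x = 0"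
    using h S by (subst (asm) le_zero_eq, subst (asm) nn_integral_0_iff_AE) auto
  then show ?thesis
    by (rule AE_mp) (auto intro!: AE_I2 simp: ennreal_eq_0_iff split: split_indicator_asm)
qed

lemma unit_ball_sets [measurable]: "unit_ball \<in> sets lebesgue" "unit_ball \<in> sets borel"
  by (auto simp: unit_ball_def)

text \<open>Off the ball the approximating test functions and their gradients are 0, so the
  approximation errors there are the fixed quantities u^2 and |g|^2; these must have integral
  0.\<close>

lemma H10_outside:
  assumes "H10 u g"
  shows "AE x in lebesgue. x \<notin> unit_ball \<longrightarrow> u x = 0 \<and> g x = 0"
proof -
  obtain \<phi> where \<phi>: "\<And>k. test_fun (\<phi> k)"
      "(\<lambda>k. \<integral>\<^sup>+ x. ennreal ((\<phi> k x - u x)\<^sup>2) \<partial>lebesgue) \<longlonglongrightarrow> 0"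
      "(\<lambda>k. \<integral>\<^sup>+ x. ennreal ((norm (grad (\<phi> k) x - g x))\<^sup>2) \<partial>lebesgue) \<longlonglongrightarrow> 0"
    and [measurable]: "u \<in> borel_measurable lebesgue" "g \<in> borel_measurable lebesgue"
    using assms unfolding H10_def by auto
  have "AE x in lebesgue. x \<in> - unit_ball \<longrightarrow> (u x)\<^sup>2 \<le> 0"
    by (rule AE_zero_of_nn_integral_tendsto_0[OF _ _ _ \<phi>(2)])
       (use test_fun_outside[OF \<phi>(1)] in auto)
  moreover have "AE x in lebesgue. x \<in> - unit_ball \<longrightarrow> (norm (g x))\<^sup>2 \<le> 0"
    by (rule AE_zero_of_nn_integral_tendsto_0[OF _ _ _ \<phi>(3)])
       (use test_fun_outside[OF \<phi>(1)] in auto)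
  ultimately show ?thesis by eventually_elim auto
qed

lemma test_fun_affine:
  fixes \<phi> :: "real^'n::finite \<Rightarrow> real"
  assumes \<phi>: "test_fun \<phi>" and a: "a > 0"
    and sub: "\<And>x. b + a *\<^sub>R x \<in> unit_ball \<Longrightarrow> x \<in> unit_ball"
  shows "test_fun (\<lambda>x. \<phi> (b + a *\<^sub>R x))"
    and "grad (\<lambda>x. \<phi> (b + a *\<^sub>R x)) x = a *\<^sub>R grad \<phi> (b + a *\<^sub>R x)"
proof -
  have sm: "smooth_fun \<phi>" using \<phi> by (simp add: test_fun_def)
  have "smooth_fun (\<lambda>x. \<phi> (b + a *\<^sub>R x))"
    unfolding smooth_fun_def
  proof
    fix k
    show "Ck_fun k (\<lambda>x. \<phi> (b + a *\<^sub>R x))"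
      using sm Ck_fun_affine[of k \<phi> 1 b a] by (simp add: smooth_fun_def)
  qed
  note sm' = this
  let ?C = "closure {x. \<phi> x \<noteq> 0}" and ?D = "{x. \<phi> (b + a *\<^sub>R x) \<noteq> 0}"
  have cl: "closed ((\<lambda>x. b + a *\<^sub>R x) -` ?C)"
    by (intro continuous_closed_vimage) (auto intro!: continuous_intros)
  have "?D \<subseteq> (\<lambda>x. b + a *\<^sub>R x) -` ?C"
    using closure_subset[of "{x. \<phi> x \<noteq> 0}"] by auto
  then have "closure ?D \<subseteq> (\<lambda>x. b + a *\<^sub>R x) -` ?C"
    using cl by (rule closure_minimal)
  also have "\<dots> \<subseteq> unit_ball"
    using \<phi> sub by (auto simp: test_fun_def)
  finally have *: "closure ?D \<subseteq> unit_ball" .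
  have "compact (closure ?D)"
    using bounded_subset[OF _ *] by (auto simp: compact_eq_bounded_closed unit_ball_def)
  with sm' * show "test_fun (\<lambda>x. \<phi> (b + a *\<^sub>R x))"
    by (auto simp: test_fun_def)
  show "grad (\<lambda>x. \<phi> (b + a *\<^sub>R x)) x = a *\<^sub>R grad \<phi> (b + a *\<^sub>R x)"
    using partial_deriv_affine(2)[of \<phi> _ 1 b a x] smooth_fun_differentiable[OF sm]
    by (simp add: grad_def vec_eq_iff)
qed

text \<open>The two squared errors are multiplied by the fixed factors a^(-N) and a^(2-N), so
  convergence to 0 persists. The assumption \<open>sub\<close> keeps the rescaled supports inside
  the ball.\<close>

lemma H10_affine:
  fixes u :: "real^'n::finite \<Rightarrow> real"
  assumes H: "H10 u g" and a: "a > 0"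
    and sub: "\<And>x. b + a *\<^sub>R x \<in> unit_ball \<Longrightarrow> x \<in> unit_ball"
  shows "H10 (\<lambda>x. u (b + a *\<^sub>R x)) (\<lambda>x. a *\<^sub>R g (b + a *\<^sub>R x))"
proof -
  obtain \<phi> where \<phi>: "\<And>k. test_fun (\<phi> k)"
      "(\<lambda>k. \<integral>\<^sup>+ x. ennreal ((\<phi> k x - u x)\<^sup>2) \<partial>lebesgue) \<longlonglongrightarrow> 0"
      "(\<lambda>k. \<integral>\<^sup>+ x. ennreal ((norm (grad (\<phi> k) x - g x))\<^sup>2) \<partial>lebesgue) \<longlonglongrightarrow> 0"
    and u[measurable]: "u \<in> borel_measurable lebesgue" and g[measurable]: "g \<in> borel_measurable lebesgue"
    using H unfolding H10_def by auto
  have a0: "a \<noteq> 0" using a by simp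
  note T = measurable_lebesgue_affine[OF a0, of b]
  have \<phi>m[measurable]: "\<phi> k \<in> borel_measurable lebesgue" "grad (\<phi> k) \<in> borel_measurable lebesgue" for k
    using borel_measurable_test_fun[OF \<phi>(1)[of k]] by (auto intro: measurable_completion)
  have grad_eq: "grad (\<lambda>x. \<phi> k (b + a *\<^sub>R x)) x = a *\<^sub>R grad (\<phi> k) (b + a *\<^sub>R x)" for k x
    by (rule test_fun_affine(2)[OF \<phi>(1) a]) (rule sub)
  have test: "test_fun (\<lambda>x. \<phi> k (b + a *\<^sub>R x))" for k
    by (rule test_fun_affine(1)[OF \<phi>(1) a]) (rule sub)
  have scale: "(\<integral>\<^sup>+x. h (b + a *\<^sub>R x) \<partial>lebesgue) = ennreal (inverse (a ^ CARD('n))) * (\<integral>\<^sup>+x. h x \<partial>lebesgue)"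
    if "h \<in> borel_measurable lebesgue" for h :: "real^'n \<Rightarrow> ennreal"
    using nn_integral_lebesgue_affine[OF that a0, of b] a
    by (simp add: mult.assoc[symmetric] ennreal_mult[symmetric])
  have "(\<lambda>k. \<integral>\<^sup>+ x. ennreal ((\<phi> k (b + a *\<^sub>R x) - u (b + a *\<^sub>R x))\<^sup>2) \<partial>lebesgue) \<longlonglongrightarrow> 0"
  proof -
    have "(\<integral>\<^sup>+ x. ennreal ((\<phi> k (b + a *\<^sub>R x) - u (b + a *\<^sub>R x))\<^sup>2) \<partial>lebesgue)
        = ennreal (inverse (a ^ CARD('n))) * (\<integral>\<^sup>+x. ennreal ((\<phi> k x - u x)\<^sup>2) \<partial>lebesgue)" for k
      by (rule scale[of "\<lambda>x. ennreal ((\<phi> k x - u x)\<^sup>2)"]) measurable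
    then show ?thesis
      using ennreal_tendsto_cmult[OF _ \<phi>(2), of "ennreal (inverse (a ^ CARD('n)))"] by simp
  qed
  moreover have "(\<lambda>k. \<integral>\<^sup>+ x. ennreal ((norm (grad (\<lambda>x. \<phi> k (b + a *\<^sub>R x)) x - a *\<^sub>R g (b + a *\<^sub>R x)))\<^sup>2) \<partial>lebesgue) \<longlonglongrightarrow> 0"
  proof -
    have "(\<integral>\<^sup>+ x. ennreal ((norm (grad (\<lambda>x. \<phi> k (b + a *\<^sub>R x)) x - a *\<^sub>R g (b + a *\<^sub>R x)))\<^sup>2) \<partial>lebesgue)
        = ennreal (inverse (a ^ CARD('n))) * (ennreal (a\<^sup>2) * (\<integral>\<^sup>+x. ennreal ((norm (grad (\<phi> k) x - g x))\<^sup>2) \<partial>lebesgue))" for k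
    proof -
      have "(\<integral>\<^sup>+ x. ennreal ((norm (grad (\<lambda>x. \<phi> k (b + a *\<^sub>R x)) x - a *\<^sub>R g (b + a *\<^sub>R x)))\<^sup>2) \<partial>lebesgue)
         = (\<integral>\<^sup>+ x. ennreal (a\<^sup>2) * ennreal ((norm (grad (\<phi> k) (b + a *\<^sub>R x) - g (b + a *\<^sub>R x)))\<^sup>2) \<partial>lebesgue)"
        unfolding grad_eq scaleR_diff_right[symmetric] norm_scaleR
        using a by (simp add: power_mult_distrib ennreal_mult)
      also have "\<dots> = ennreal (inverse (a ^ CARD('n))) * (\<integral>\<^sup>+ x. ennreal (a\<^sup>2) * ennreal ((norm (grad (\<phi> k) x - g x))\<^sup>2) \<partial>lebesgue)"
        by (rule scale[of "\<lambda>x. ennreal (a\<^sup>2) * ennreal ((norm (grad (\<phi> k) x - g x))\<^sup>2)"]) measurable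
      finally show ?thesis by (simp add: nn_integral_cmult)
    qed
    then show ?thesis
      using ennreal_tendsto_cmult[OF _ ennreal_tendsto_cmult[OF _ \<phi>(3), of "ennreal (a\<^sup>2)"], of "ennreal (inverse (a ^ CARD('n)))"] by simp
  qed
  ultimately show ?thesis
    unfolding H10_def
    using test measurable_compose[OF T u] 
      borel_measurable_scaleR[OF borel_measurable_const measurable_compose[OF T g]]
    by (intro conjI exI[of _ "\<lambda>k x. \<phi> k (b + a *\<^sub>R x)"]) auto
qed

lemma H10_integral_grad:
  assumes "H10 u g"
  shows "(\<integral>x\<in>unit_ball. (norm (g x))\<^sup>2 \<partial>lebesgue) = (\<integral>x. (norm (g x))\<^sup>2 \<partial>lebesgue)"
proof -
  have [measurable]: "g \<in> borel_measurable lebesgue" using assms by (simp add: H10_def)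
  have "AE x in lebesgue. indicat_real unit_ball x *\<^sub>R (norm (g x))\<^sup>2 = (norm (g x))\<^sup>2"
    using H10_outside[OF assms] by eventually_elim (auto split: split_indicator)
  then show ?thesis
    unfolding set_lebesgue_integral_def by (intro integral_cong_AE) auto
qed

text \<open>A Bochner integral that does not converge has the value 0. In the numerator this makes
  the quotient 0, and in the denominator it does so through 0 powr y = 0 and x / 0 = 0.\<close>

lemma rayleigh_pos_imp_integrable:
  assumes "rayleigh W p u g > 0"
  shows "set_integrable lebesgue unit_ball (\<lambda>x. W (norm x) * \<bar>u x\<bar> powr (p + 1))"
    and "set_integrable lebesgue unit_ball (\<lambda>x. (norm (g x))\<^sup>2)"
  using assms not_integrable_integral_eq
  by (fastforce simp: rayleigh_def set_integrable_def set_lebesgue_integral_def)+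

text \<open>The function used is v(x) = u((x - c)/\<delta>), concentrated on
  \<open>ball c \<delta>\<close>. Its energy is \<delta>^(N-2) times that of u, while the weighted
  integral is at least b \<delta>^N times the unweighted one of u; taking the power 2/(p+1) gives
  the stated factors.\<close>

lemma rayleigh_rescale:
  fixes u :: "real^'n::finite \<Rightarrow> real" and c :: "real^'n"
  assumes H: "H10 u g" and p: "p > 1" and \<delta>: "0 < \<delta>" and sub: "ball c \<delta> \<subseteq> unit_ball"
    and W[measurable]: "W \<in> borel_measurable borel"
    and W01: "\<And>r. 0 \<le> r \<Longrightarrow> r < 1 \<Longrightarrow> 0 \<le> W r \<and> W r \<le> 1"
    and Wb: "\<And>x. x \<in> ball c \<delta> \<Longrightarrow> b \<le> W (norm x)" and b: "b > 0"
    and pos: "rayleigh (\<lambda>_. 1) p u g > 0"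
  obtains v :: "real^'n \<Rightarrow> real" and gv where "H10 v gv" "nonzero_fun v"
    "rayleigh W p v gv \<le> \<delta> powr (real CARD('n) - 2 - 2 * real CARD('n) / (p + 1)) *
       b powr (- 2 / (p + 1)) * rayleigh (\<lambda>_. 1) p u g"
proof -
  define a where "a = 1 / \<delta>"
  define t where "t = - (a *\<^sub>R c)"
  let ?T = "\<lambda>x. t + a *\<^sub>R x"
  define v where "v x = u (?T x)" for x
  define gv where "gv x = a *\<^sub>R g (?T x)" for x
  have a: "a > 0" "a \<noteq> 0" using \<delta> by (auto simp: a_def)
  have T_iff: "?T x \<in> unit_ball \<longleftrightarrow> x \<in> ball c \<delta>" for x
  proof -
    have "?T x = a *\<^sub>R (x - c)" by (simp add: t_def algebra_simps)
    then have "norm (?T x) = dist c x / \<delta>" using \<delta> by (simp add: a_def dist_norm norm_minus_commute)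
    then show ?thesis using \<delta> by (simp add: unit_ball_def)
  qed
  have Hv: "H10 v gv"
    unfolding v_def[abs_def] gv_def[abs_def]
    by (rule H10_affine[OF H a(1)]) (use T_iff sub in blast)
  have um[measurable]: "u \<in> borel_measurable lebesgue" "g \<in> borel_measurable lebesgue"
    using H by (auto simp: H10_def)
  have vm[measurable]: "v \<in> borel_measurable lebesgue" "gv \<in> borel_measurable lebesgue"
    using Hv by (auto simp: H10_def)
  have Wm[measurable]: "(\<lambda>x::real^'n. W (norm x)) \<in> borel_measurable lebesgue"
    by (intro measurable_completion) simp
  define A where "A = (\<integral>x\<in>unit_ball. (norm (g x))\<^sup>2 \<partial>lebesgue)"
  define D where "D = (\<integral>x\<in>unit_ball. \<bar>u x\<bar> powr (p + 1) \<partial>lebesgue)"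
  define A' where "A' = (\<integral>x\<in>unit_ball. (norm (gv x))\<^sup>2 \<partial>lebesgue)"
  define D' where "D' = (\<integral>x\<in>unit_ball. W (norm x) * \<bar>v x\<bar> powr (p + 1) \<partial>lebesgue)"
  have r: "rayleigh (\<lambda>_. 1) p u g = A / D powr (2 / (p + 1))"
    by (simp add: rayleigh_def A_def D_def)
  have r': "rayleigh W p v gv = A' / D' powr (2 / (p + 1))"
    by (simp add: rayleigh_def A'_def D'_def)
  have "A \<ge> 0" "D \<ge> 0" unfolding A_def D_def set_lebesgue_integral_def by auto
  with pos r have AD: "A > 0" "D > 0"
    by (auto simp: zero_less_divide_iff order.order_iff_strict)
  let ?f = "\<lambda>x. indicat_real unit_ball x * \<bar>u x\<bar> powr (p + 1)"
  have fi: "integrable lebesgue ?f"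
    using rayleigh_pos_imp_integrable(1)[OF pos] by (simp add: set_integrable_def)
  have fTi: "integrable lebesgue (\<lambda>x. ?f (?T x))"
    by (rule integrable_lebesgue_affine[OF fi a(2)])
  have an: "inverse (a ^ CARD('n)) = \<delta> ^ CARD('n)" "a\<^sup>2 = inverse (\<delta>\<^sup>2)"
    using \<delta> by (auto simp: a_def field_simps power_divide)
  have A': "A' = inverse (\<delta>\<^sup>2) * \<delta> ^ CARD('n) * A"
  proof -
    have "A = a ^ CARD('n) * (\<integral>x. (norm (g (?T x)))\<^sup>2 \<partial>lebesgue)"
      unfolding A_def H10_integral_grad[OF H]
      using integral_lebesgue_affine[of "\<lambda>x. (norm (g x))\<^sup>2" a t] a by simp
    then have "(\<integral>x. (norm (g (?T x)))\<^sup>2 \<partial>lebesgue) = \<delta> ^ CARD('n) * A"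
      unfolding an(1)[symmetric] using a by simp
    moreover have "A' = (\<integral>x. a\<^sup>2 * (norm (g (?T x)))\<^sup>2 \<partial>lebesgue)"
      unfolding A'_def H10_integral_grad[OF Hv] by (simp add: gv_def power_mult_distrib)
    ultimately show ?thesis by (simp add: an)
  qed
  have fT: "(\<integral>x. ?f (?T x) \<partial>lebesgue) = \<delta> ^ CARD('n) * D"
  proof -
    have "D = a ^ CARD('n) * (\<integral>x. ?f (?T x) \<partial>lebesgue)"
      unfolding D_def set_lebesgue_integral_def
      using integral_lebesgue_affine[of ?f a t] a by simp
    then show ?thesis unfolding an(1)[symmetric] using a by simp
  qed
  let ?F = "\<lambda>x. indicat_real unit_ball x * (W (norm x) * \<bar>v x\<bar> powr (p + 1))"
  \<comment> \<open>The exceptional null set of u has to be pulled back along the affine map. This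
    is done by rescaling the integral of the indicator \<open>?Z\<close> of that set.\<close>
  have v0: "AE x in lebesgue. x \<notin> ball c \<delta> \<longrightarrow> v x = 0"
  proof -
    let ?Z = "\<lambda>x. if x \<in> - unit_ball \<and> u x \<noteq> 0 then 1 else (0::real)"
    have Zm: "?Z \<in> borel_measurable lebesgue" by measurable
    have "(\<integral>\<^sup>+x. ennreal (?Z x) \<partial>lebesgue) = 0"
    proof (subst nn_integral_0_iff_AE)
      show "AE x in lebesgue. ennreal (?Z x) = 0"
        using H10_outside[OF H] by eventually_elim auto
    qed (use Zm in auto)
    then have Z0: "ennreal (\<bar>a\<bar> ^ CARD('n)) * (\<integral>\<^sup>+x. ennreal (?Z (?T x)) \<partial>lebesgue) = 0"
      using nn_integral_lebesgue_affine[of "\<lambda>x. ennreal (?Z x)" a t] Zm a by simp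
    have "(\<integral>\<^sup>+x. ennreal (?Z (?T x)) \<partial>lebesgue) = 0"
    proof -
      have "ennreal (\<bar>a\<bar> ^ CARD('n)) \<noteq> 0" using a by (simp add: ennreal_eq_0_iff not_le)
      with Z0 show ?thesis unfolding mult_eq_0_iff by blast
    qed
    then have "AE x in lebesgue. ennreal (?Z (?T x)) = 0"
      using measurable_compose[OF measurable_lebesgue_affine[OF a(2)] Zm]
      by (subst (asm) nn_integral_0_iff_AE) auto
    then show ?thesis
      by eventually_elim (use T_iff in \<open>auto simp: v_def split: if_splits\<close>)
  qed
  \<comment> \<open>The upper estimate (from W at most 1) gives integrability of the weighted
    integrand; the lower one (from W at least b) gives the lower bound on the denominator.\<close>
  have bound: "AE x in lebesgue. 0 \<le> ?F x \<and> ?F x \<le> ?f (?T x) \<and> b * ?f (?T x) \<le> ?F x"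
    using v0
  proof eventually_elim
    case (elim x)
    show ?case
    proof (cases "x \<in> ball c \<delta>")
      case True
      then have x: "x \<in> unit_ball" "norm x < 1" using sub by (auto simp: unit_ball_def)
      have "b \<le> W (norm x)" "0 \<le> W (norm x)" "W (norm x) \<le> 1"
        using Wb[OF True] W01[of "norm x"] x by auto
      moreover have "?T x \<in> unit_ball" using T_iff True by blast
      ultimately show ?thesis
        using x by (auto simp: v_def mult_left_le_one_le mult_right_mono)
    next
      case False
      then have "?T x \<notin> unit_ball" using T_iff by blast
      then show ?thesis using elim False by simp
    qed
  qed
  have "AE x in lebesgue. norm (?F x) \<le> norm (?f (?T x))"
    using bound by eventually_elim auto
  then have Fi: "integrable lebesgue ?F"
    by (intro Bochner_Integration.integrable_bound[OF fTi]) auto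
  have D': "b * \<delta> ^ CARD('n) * D \<le> D'"
  proof -
    have "b * (\<integral>x. ?f (?T x) \<partial>lebesgue) = (\<integral>x. b * ?f (?T x) \<partial>lebesgue)" by simp
    also have "\<dots> \<le> (\<integral>x. ?F x \<partial>lebesgue)"
    proof (rule integral_mono_AE)
      show "AE x in lebesgue. b * ?f (?T x) \<le> ?F x"
        using bound by eventually_elim auto
    qed (use fTi Fi in auto)
    also have "\<dots> = D'" by (simp add: D'_def set_lebesgue_integral_def)
    finally show ?thesis unfolding fT by (simp add: mult.assoc)
  qed
  have bd: "b * \<delta> ^ CARD('n) * D > 0" using b \<delta> AD by simp
  have nz: "nonzero_fun v"
    unfolding nonzero_fun_def
  proof
    assume "AE x in lebesgue. v x = 0"
    then have "AE x in lebesgue. ?F x = 0" by eventually_elim auto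
    then have "D' = 0" unfolding D'_def set_lebesgue_integral_def
      by (simp add: integral_eq_zero_AE)
    with D' bd show False by simp
  qed
  let ?q = "2 / (p + 1)"
  have "rayleigh W p v gv \<le> A' / (b * \<delta> ^ CARD('n) * D) powr ?q"
    unfolding r' using D' bd p AD \<delta> A'
    by (intro divide_left_mono powr_mono2 mult_pos_pos) (auto)
  also have "\<dots> = \<delta> powr (real CARD('n) - 2 - 2 * real CARD('n) / (p + 1)) * b powr (- 2 / (p + 1)) * (A / D powr ?q)"
  proof -
    have 1: "(b * \<delta> ^ CARD('n) * D) powr ?q = b powr ?q * \<delta> powr (real CARD('n) * ?q) * D powr ?q"
      using b \<delta> AD by (simp add: powr_mult powr_realpow[symmetric] powr_powr)
    have 2: "inverse (\<delta>\<^sup>2) * \<delta> ^ CARD('n) = \<delta> powr (real CARD('n) - 2)"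
      using \<delta> by (simp add: powr_diff powr_realpow divide_inverse powr_numeral)
    have 3: "\<delta> powr (real CARD('n) - 2 - 2 * real CARD('n) / (p + 1)) = \<delta> powr (real CARD('n) - 2) / \<delta> powr (real CARD('n) * ?q)"
      by (simp add: powr_diff mult.commute)
    have 4: "b powr (- 2 / (p + 1)) = inverse (b powr ?q)"
      by (simp add: powr_minus[symmetric])
    show ?thesis unfolding A' 1 2 3 4 by (simp add: field_simps)
  qed
  finally have "rayleigh W p v gv \<le> \<delta> powr (real CARD('n) - 2 - 2 * real CARD('n) / (p + 1)) *
       b powr (- 2 / (p + 1)) * rayleigh (\<lambda>_. 1) p u g" unfolding r .
  from that[OF Hv nz this] show ?thesis .
qed

section \<open>Integration along rays and in spherical shells\<close>

lemma sphere_area_eq_unit_ball_vol: "n > 0 \<Longrightarrow> sphere_area n = real n * unit_ball_vol (real n)"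
proof -
  assume n: "n > 0"
  have G: "Gamma (real n / 2 + 1) = real n / 2 * Gamma (real n / 2)"
    using n by (intro Gamma_plus1) (auto elim!: nonpos_Ints_cases)
  show ?thesis
    using n by (simp add: sphere_area_def unit_ball_vol_def G)
qed

lemma sphere_area_pos: "n > 0 \<Longrightarrow> sphere_area n > 0"
  by (simp add: sphere_area_eq_unit_ball_vol)

text \<open>Both measures give \<open>{..a}\<close> the volume of the ball of radius a, and these
  half lines form an intersection-stable generator of the Borel sets. Only radial integrands are
  covered, so no measure on the sphere is involved.\<close>

lemma distr_norm_lborel:
  defines "n \<equiv> DIM('a::euclidean_space)"
  shows "distr lborel borel (norm :: 'a \<Rightarrow> real) =
    density lborel (\<lambda>s. ennreal (sphere_area n * s ^ (n - 1)) * indicator {0..} s)"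
    (is "?M = ?N")
proof (rule measure_eqI_generator_eq[where E="range (\<lambda>a::real. {..a})" and \<Omega>=UNIV and A="\<lambda>i. {..real i}"])
  have n: "n > 0" by (simp add: n_def)
  show "Int_stable (range (\<lambda>a::real. {..a}))"
    by (auto simp: Int_stable_def)
  have borel: "sets borel = sigma_sets UNIV (range (\<lambda>a::real. {..a}))"
    unfolding borel_eq_atMost by simp
  show "sets ?M = sigma_sets UNIV (range (\<lambda>a::real. {..a}))" "sets ?N = sigma_sets UNIV (range (\<lambda>a::real. {..a}))"
    using borel by simp_all
  show "(\<Union>i. {..real i}) = UNIV"
    by (auto intro: real_arch_simple)
  have M: "emeasure ?M {..a} = (if a < 0 then 0 else ennreal (unit_ball_vol n * a ^ n))" for a
  proof -
    have "emeasure ?M {..a} = emeasure lborel (norm -` {..a} :: 'a set)"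
      by (subst emeasure_distr) auto
    also have "(norm -` {..a} :: 'a set) = cball 0 a" by auto
    finally show ?thesis by (auto simp: emeasure_cball n_def)
  qed
  then show "emeasure ?M {..real i} \<noteq> \<infinity>" for i by simp
  show "emeasure ?M X = emeasure ?N X" if X: "X \<in> range (\<lambda>a. {..a})" for X
  proof -
    from X obtain a where X: "X = {..a}" by auto
    have "emeasure ?N X = (\<integral>\<^sup>+s. ennreal (sphere_area n * s ^ (n - 1)) * indicator {0..a} s \<partial>lborel)"
      unfolding X by (subst emeasure_density) (auto intro!: nn_integral_cong split: split_indicator)
    also have "\<dots> = emeasure ?M X"
    proof (cases "a < 0")
      case False
      have "(\<integral>\<^sup>+s. ennreal (sphere_area n * s ^ (n - 1)) * indicator {0..a} s \<partial>lborel)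
         = ennreal (unit_ball_vol n * a ^ n - unit_ball_vol n * 0 ^ n)"
        using False n
        by (intro nn_integral_FTC_Icc)
           (auto intro!: derivative_eq_intros mult_nonneg_nonneg less_imp_le[OF sphere_area_pos]
             simp: sphere_area_eq_unit_ball_vol)
      then show ?thesis using False n by (simp add: M X)
    qed (simp add: M X)
    finally show ?thesis by simp
  qed
qed auto

lemma nn_integral_radial:
  assumes [measurable]: "F \<in> borel_measurable borel"
  shows "(\<integral>\<^sup>+x. F (norm (x::'a::euclidean_space)) \<partial>lborel) =
    (\<integral>\<^sup>+s. ennreal (sphere_area DIM('a) * s ^ (DIM('a) - 1)) * indicator {0..} s * F s \<partial>lborel)"
proof -
  have "(\<integral>\<^sup>+x. F (norm (x::'a)) \<partial>lborel) = (\<integral>\<^sup>+s. F s \<partial>distr lborel borel (norm :: 'a \<Rightarrow> real))"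
    by (subst nn_integral_distr) auto
  then show ?thesis
    unfolding distr_norm_lborel by (simp add: nn_integral_density)
qed

text \<open>The fundamental theorem of calculus is applied along the ray from x to x / r, whose end
  lies outside the open unit ball because |x| is at least r. The upper limit 1/r is the same for all
  such x, so that the range of t stays fixed when the integrals are exchanged.\<close>

lemma test_fun_le_ray_integral:
  fixes \<phi> :: "real^'n::finite \<Rightarrow> real"
  assumes \<phi>: "test_fun \<phi>" and r: "0 < r" "r \<le> 1" "r \<le> norm x"
  shows "ennreal \<bar>\<phi> x\<bar> \<le> (\<integral>\<^sup>+t. ennreal (norm (grad \<phi> (t *\<^sub>R x)) * norm x) * indicator {1..1/r} t \<partial>lborel)"
proof -
  have sm: "smooth_fun \<phi>" using \<phi> by (simp add: test_fun_def)
  have end0: "\<phi> ((1/r) *\<^sub>R x) = 0"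
    using r by (intro test_fun_outside(1)[OF \<phi>]) (auto simp: unit_ball_def)
  have d: "((\<lambda>t. \<phi> (t *\<^sub>R x)) has_vector_derivative grad \<phi> (t *\<^sub>R x) \<bullet> x) (at t within S)" for t S
  proof -
    have "((\<lambda>t. t *\<^sub>R x) has_derivative (\<lambda>h. h *\<^sub>R x)) (at t within S)"
      by (auto intro!: derivative_eq_intros)
    from has_derivative_compose[OF this has_derivative_grad[OF smooth_fun_differentiable[OF sm]]]
    show ?thesis by (simp add: has_vector_derivative_def)
  qed
  have le: "1 \<le> 1/r" using r by simp
  from fundamental_theorem_of_calculus[OF le d]
  have I: "((\<lambda>t. grad \<phi> (t *\<^sub>R x) \<bullet> x) has_integral - \<phi> x) {1..1/r}"
    using end0 by simp
  have c: "continuous_on {1..1/r} (\<lambda>t. norm (grad \<phi> (t *\<^sub>R x)) * norm x)"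
    by (intro continuous_intros continuous_on_compose2[OF smooth_fun_continuous_grad[OF sm]]) auto
  then have J: "((\<lambda>t. norm (grad \<phi> (t *\<^sub>R x)) * norm x) has_integral
      integral {1..1/r} (\<lambda>t. norm (grad \<phi> (t *\<^sub>R x)) * norm x)) {1..1/r}"
    by (intro integrable_integral integrable_continuous_real)
  have "\<bar>\<phi> x\<bar> \<le> integral {1..1/r} (\<lambda>t. norm (grad \<phi> (t *\<^sub>R x)) * norm x)"
  proof -
    have "norm (integral {1..1/r} (\<lambda>t. grad \<phi> (t *\<^sub>R x) \<bullet> x)) \<le> integral {1..1/r} (\<lambda>t. norm (grad \<phi> (t *\<^sub>R x)) * norm x)"
      using I J by (intro integral_norm_bound_integral) (auto simp: Cauchy_Schwarz_ineq2)
    then show ?thesis using integral_unique[OF I] by simp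
  qed
  then have "ennreal \<bar>\<phi> x\<bar> \<le> ennreal (integral {1..1/r} (\<lambda>t. norm (grad \<phi> (t *\<^sub>R x)) * norm x))"
    by (rule ennreal_leI)
  also have "\<dots> = (\<integral>\<^sup>+t. ennreal (indicator {1..1/r} t * (norm (grad \<phi> (t *\<^sub>R x)) * norm x)) \<partial>lborel)"
    using nn_integral_has_integral_lebesgue[OF _ J] by simp
  also have "\<dots> = (\<integral>\<^sup>+t. ennreal (norm (grad \<phi> (t *\<^sub>R x)) * norm x) * indicator {1..1/r} t \<partial>lborel)"
    by (intro nn_integral_cong) (auto split: split_indicator)
  finally show ?thesis .
qed

text \<open>The substitution is s = y / t. Since y / t decreases in t, it is carried out with -(y /
  t), and the indicator is reflected back at the end. The image interval [r y, y] is enlarged to all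
  s at most y.\<close>

lemma nn_integral_inversion_le:
  assumes C[measurable]: "C \<in> sets borel" and r: "0 < r" "r < 1" and y: "0 \<le> y"
  shows "(\<integral>\<^sup>+t. ennreal (y / t\<^sup>2) * indicator C (y / t) * indicator {1..1/r} t \<partial>lborel)
    \<le> (\<integral>\<^sup>+s. indicator C s * indicator {..y} s \<partial>lborel)"
proof -
  let ?f = "\<lambda>s. indicator C (- s) :: ennreal"
  have "(\<integral>\<^sup>+t. ennreal (y / t\<^sup>2) * indicator C (y / t) * indicator {1..1/r} t \<partial>lborel)
     = (\<integral>\<^sup>+t. ?f (- (y / t)) * ennreal (y / t\<^sup>2) * indicator {1..1/r} t \<partial>lborel)"
    by (intro nn_integral_cong) (auto simp: mult_ac)
  also have "\<dots> = (\<integral>\<^sup>+s. ?f s * indicator {- (y / 1) .. - (y / (1/r))} s \<partial>lborel)"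
    using r y
    by (intro nn_integral_substitution_aux[symmetric])
       (auto intro!: derivative_eq_intros continuous_intros simp: power2_eq_square)
  also have "\<dots> \<le> (\<integral>\<^sup>+s. indicator C (- s) * indicator {..y} (- s) \<partial>lborel)"
    by (intro nn_integral_mono) (auto split: split_indicator)
  also have "\<dots> = (\<integral>\<^sup>+s. indicator C s * indicator {..y} s \<partial>lborel)"
    by (subst nn_integral_real_affine[where c="-1" and t=0]) auto
  finally show ?thesis .
qed

text \<open>
  Bounds the integral over x by the ray integrals over t, substitutes y = t x for fixed t and then
  s = |y| / t for fixed y. Since only nonnegative integrands occur, Tonelli suffices and no
  divergence theorem is needed.
\<close>
lemma nn_integral_test_fun_shell_le:
  fixes \<phi> :: "real^'n::finite \<Rightarrow> real"
  assumes \<phi>: "test_fun \<phi>" and r: "0 < r" "r < 1"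
    and C[measurable]: "C \<in> sets borel" and Cr: "\<And>s. s \<in> C \<Longrightarrow> r \<le> s"
  shows "(\<integral>\<^sup>+x. ennreal (\<bar>\<phi> x\<bar> / norm x ^ (CARD('n) - 1)) * indicator C (norm x) \<partial>lborel)
    \<le> (\<integral>\<^sup>+s. indicator C s *
          (\<integral>\<^sup>+y. ennreal (norm (grad \<phi> y) / norm y ^ (CARD('n) - 1)) * indicator {s..} (norm y) \<partial>lborel) \<partial>lborel)"
proof -
  let ?k = "CARD('n) - 1"
  have n: "CARD('n) = Suc ?k" by simp
  have gm[measurable]: "grad \<phi> \<in> borel_measurable borel"
    using borel_measurable_test_fun[OF \<phi>] by simp
  let ?A = "\<lambda>x t. ennreal (norm (grad \<phi> (t *\<^sub>R x)) * norm x / norm x ^ ?k) * indicator C (norm x) * indicator {1..1/r} t"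
  let ?B = "\<lambda>y t. ennreal (norm (grad \<phi> y) / norm y ^ ?k) * (ennreal (norm y / t\<^sup>2) * indicator C (norm y / t) * indicator {1..1/r} t)"
  have "(\<integral>\<^sup>+x. ennreal (\<bar>\<phi> x\<bar> / norm x ^ ?k) * indicator C (norm x) \<partial>lborel)
      \<le> (\<integral>\<^sup>+x. (\<integral>\<^sup>+t. ?A x t \<partial>lborel) \<partial>lborel)"
  proof (rule nn_integral_mono)
    fix x :: "real^'n"
    show "ennreal (\<bar>\<phi> x\<bar> / norm x ^ ?k) * indicator C (norm x) \<le> (\<integral>\<^sup>+t. ?A x t \<partial>lborel)"
    proof (cases "norm x \<in> C")
      case True
      then have nx: "r \<le> norm x" using Cr by auto
      have "ennreal (\<bar>\<phi> x\<bar> / norm x ^ ?k) = ennreal (1 / norm x ^ ?k) * ennreal \<bar>\<phi> x\<bar>"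
        by (simp add: ennreal_mult[symmetric])
      also have "\<dots> \<le> ennreal (1 / norm x ^ ?k) * (\<integral>\<^sup>+t. ennreal (norm (grad \<phi> (t *\<^sub>R x)) * norm x) * indicator {1..1/r} t \<partial>lborel)"
        using r nx by (intro mult_left_mono test_fun_le_ray_integral[OF \<phi>]) auto
      also have "\<dots> = (\<integral>\<^sup>+t. ennreal (1 / norm x ^ ?k) * (ennreal (norm (grad \<phi> (t *\<^sub>R x)) * norm x) * indicator {1..1/r} t) \<partial>lborel)"
        by (rule nn_integral_cmult[symmetric]) measurable
      also have "\<dots> = (\<integral>\<^sup>+t. ?A x t \<partial>lborel)"
        using True by (intro nn_integral_cong) (auto simp: ennreal_mult[symmetric] split: split_indicator)
      finally show ?thesis using True by simp
    qed auto
  qed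
  also have "\<dots> = (\<integral>\<^sup>+t. (\<integral>\<^sup>+x. ?A x t \<partial>lborel) \<partial>lborel)"
    by (rule lborel_pair.Fubini'[symmetric]) measurable
  also have "\<dots> = (\<integral>\<^sup>+t. (\<integral>\<^sup>+y. ?B y t \<partial>lborel) \<partial>lborel)"
  proof (rule nn_integral_cong)
    fix t :: real
    show "(\<integral>\<^sup>+x. ?A x t \<partial>lborel) = (\<integral>\<^sup>+y. ?B y t \<partial>lborel)"
    proof (cases "t \<in> {1..1/r}")
      case True
      then have t: "t > 0" by auto
      have "(\<integral>\<^sup>+x. ?A x t \<partial>lborel) = (\<integral>\<^sup>+x. ?A x t \<partial>lebesgue)"
        by (simp add: nn_integral_completion)
      also have "\<dots> = ennreal (\<bar>1/t\<bar> ^ DIM(real^'n)) * (\<integral>\<^sup>+x. ?A (0 + (1/t) *\<^sub>R x) t \<partial>lebesgue)"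
        by (rule nn_integral_lebesgue_affine) (use t in \<open>auto intro!: measurable_completion\<close>)
      also have "\<dots> = ennreal (\<bar>1/t\<bar> ^ CARD('n)) * (\<integral>\<^sup>+x. ?A (0 + (1/t) *\<^sub>R x) t \<partial>lborel)"
        by (simp add: nn_integral_completion)
      also have "\<dots> = (\<integral>\<^sup>+x. ennreal (\<bar>1/t\<bar> ^ CARD('n)) * ?A (0 + (1/t) *\<^sub>R x) t \<partial>lborel)"
        by (rule nn_integral_cmult[symmetric]) measurable
      also have "\<dots> = (\<integral>\<^sup>+y. ?B y t \<partial>lborel)"
      proof (rule nn_integral_cong)
        fix y :: "real^'n"
        \<comment> \<open>The weight |x|^(1-N) is chosen for this cancellation: with the Jacobian
          t^(-N) it leaves |y| / t^2, the modulus of the t-derivative of |y| / t, which is what the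
          substitution in t requires.\<close>
        have "\<bar>1/t\<bar> ^ CARD('n) * (norm (grad \<phi> y) * (norm y / t) / (norm y / t) ^ ?k)
           = norm (grad \<phi> y) / norm y ^ ?k * (norm y / t\<^sup>2)"
        proof -
          have "t ^ CARD('n) = t * t ^ ?k" by (subst n) (simp only: power_Suc)
          then show ?thesis using t by (simp add: field_simps power_divide power2_eq_square)
        qed
        then show "ennreal (\<bar>1/t\<bar> ^ CARD('n)) * ?A (0 + (1/t) *\<^sub>R y) t = ?B y t"
          using t True by (auto simp: ennreal_mult[symmetric] split: split_indicator)
      qed
      finally show ?thesis .
    qed auto
  qed
  also have "\<dots> = (\<integral>\<^sup>+y. (\<integral>\<^sup>+t. ?B y t \<partial>lborel) \<partial>lborel)"
    by (rule lborel_pair.Fubini') measurable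
  also have "\<dots> \<le> (\<integral>\<^sup>+y. ennreal (norm (grad \<phi> y) / norm y ^ ?k) * (\<integral>\<^sup>+s. indicator C s * indicator {..norm y} s \<partial>lborel) \<partial>lborel)"
  proof (rule nn_integral_mono)
    fix y :: "real^'n"
    have "(\<integral>\<^sup>+t. ?B y t \<partial>lborel) = ennreal (norm (grad \<phi> y) / norm y ^ ?k) *
       (\<integral>\<^sup>+t. ennreal (norm y / t\<^sup>2) * indicator C (norm y / t) * indicator {1..1/r} t \<partial>lborel)"
      by (rule nn_integral_cmult) measurable
    also have "\<dots> \<le> ennreal (norm (grad \<phi> y) / norm y ^ ?k) * (\<integral>\<^sup>+s. indicator C s * indicator {..norm y} s \<partial>lborel)"
      by (intro mult_left_mono nn_integral_inversion_le r) auto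
    finally show "(\<integral>\<^sup>+t. ?B y t \<partial>lborel) \<le> \<dots>" .
  qed
  also have "\<dots> = (\<integral>\<^sup>+y. (\<integral>\<^sup>+s. ennreal (norm (grad \<phi> y) / norm y ^ ?k) * (indicator C s * indicator {s..} (norm y)) \<partial>lborel) \<partial>lborel)"
  proof (rule nn_integral_cong)
    fix y :: "real^'n"
    show "ennreal (norm (grad \<phi> y) / norm y ^ ?k) * (\<integral>\<^sup>+s. indicator C s * indicator {..norm y} s \<partial>lborel)
      = (\<integral>\<^sup>+s. ennreal (norm (grad \<phi> y) / norm y ^ ?k) * (indicator C s * indicator {s..} (norm y)) \<partial>lborel)"
      by (subst nn_integral_cmult[symmetric]) (auto intro!: nn_integral_cong split: split_indicator)
  qed
  also have "\<dots> = (\<integral>\<^sup>+s. (\<integral>\<^sup>+y. ennreal (norm (grad \<phi> y) / norm y ^ ?k) * (indicator C s * indicator {s..} (norm y)) \<partial>lborel) \<partial>lborel)"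
    by (rule lborel_pair.Fubini'[symmetric]) (simp add: indicator_def[of "atLeast _"] cong: if_cong)
  also have "\<dots> = (\<integral>\<^sup>+s. indicator C s *
          (\<integral>\<^sup>+y. ennreal (norm (grad \<phi> y) / norm y ^ ?k) * indicator {s..} (norm y) \<partial>lborel) \<partial>lborel)"
    by (intro nn_integral_cong) (subst nn_integral_cmult[symmetric], auto simp: mult_ac)
  finally show ?thesis .
qed

section \<open>Square-integral inequalities and the radial majorant\<close>

lemma ennreal_square_le_imp_le:
  assumes "x\<^sup>2 \<le> ennreal (y\<^sup>2)" "0 \<le> y" shows "x \<le> ennreal y"
proof (cases x rule: ennreal_cases)
  case (real a)
  then have "a\<^sup>2 \<le> y\<^sup>2" using assms by (simp add: ennreal_power)
  then show ?thesis using assms real by (auto intro: ennreal_leI power2_le_imp_le)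
next
  case top
  then show ?thesis using assms by (simp add: power2_eq_square top_unique)
qed

text \<open>Cauchy-Schwarz with real bounds a and b on the L2 norms, a form that avoids square roots
  of extended reals.\<close>

lemma nn_integral_mult_le_of_squares:
  assumes [measurable]: "f \<in> borel_measurable M" "g \<in> borel_measurable M"
    and f: "(\<integral>\<^sup>+x. (f x)\<^sup>2 \<partial>M) \<le> ennreal (a\<^sup>2)" and g: "(\<integral>\<^sup>+x. (g x)\<^sup>2 \<partial>M) \<le> ennreal (b\<^sup>2)"
    and ab: "0 \<le> a" "0 \<le> b"
  shows "(\<integral>\<^sup>+x. f x * g x \<partial>M) \<le> ennreal (a * b)"
proof (rule ennreal_square_le_imp_le)
  have "(\<integral>\<^sup>+x. f x * g x \<partial>M)\<^sup>2 \<le> (\<integral>\<^sup>+x. (f x)\<^sup>2 \<partial>M) * (\<integral>\<^sup>+x. (g x)\<^sup>2 \<partial>M)"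
    by (rule Cauchy_Schwarz_nn_integral) auto
  also have "\<dots> \<le> ennreal (a\<^sup>2) * ennreal (b\<^sup>2)" by (intro mult_mono f g) auto
  finally show "(\<integral>\<^sup>+x. f x * g x \<partial>M)\<^sup>2 \<le> ennreal ((a * b)\<^sup>2)"
    by (simp add: ennreal_mult power_mult_distrib)
qed (use ab in simp)

text \<open>Minkowski's inequality in L2 with real bounds: the square is expanded and Cauchy-Schwarz
  is applied to the cross term.\<close>

lemma nn_integral_add_square_le:
  assumes [measurable]: "f \<in> borel_measurable M" "g \<in> borel_measurable M"
    and f: "(\<integral>\<^sup>+x. (f x)\<^sup>2 \<partial>M) \<le> ennreal (a\<^sup>2)" and g: "(\<integral>\<^sup>+x. (g x)\<^sup>2 \<partial>M) \<le> ennreal (b\<^sup>2)"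
    and ab: "0 \<le> a" "0 \<le> b"
  shows "(\<integral>\<^sup>+x. (f x + g x)\<^sup>2 \<partial>M) \<le> ennreal ((a + b)\<^sup>2)"
proof -
  have "(\<integral>\<^sup>+x. (f x + g x)\<^sup>2 \<partial>M) = (\<integral>\<^sup>+x. (f x)\<^sup>2 + (g x)\<^sup>2 + 2 * (f x * g x) \<partial>M)"
    by (intro nn_integral_cong) (simp add: power2_sum mult.assoc)
  also have "\<dots> = (\<integral>\<^sup>+x. (f x)\<^sup>2 \<partial>M) + (\<integral>\<^sup>+x. (g x)\<^sup>2 \<partial>M) + 2 * (\<integral>\<^sup>+x. f x * g x \<partial>M)"
    by (simp add: nn_integral_add nn_integral_cmult)
  also have "\<dots> \<le> ennreal (a\<^sup>2) + ennreal (b\<^sup>2) + 2 * ennreal (a * b)"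
    by (intro add_mono mult_left_mono f g nn_integral_mult_le_of_squares[OF _ _ f g ab]) auto
  also have "\<dots> = ennreal (a\<^sup>2) + ennreal (b\<^sup>2) + ennreal (2 * (a * b))"
    using ab by (simp add: ennreal_mult)
  also have "\<dots> = ennreal ((a + b)\<^sup>2)"
    using ab by (simp add: ennreal_plus[symmetric] power2_sum algebra_simps del: ennreal_plus)
  finally show ?thesis .
qed

text \<open>The square is the integral of \<sigma>^(1-n) over [s,1] divided by the sphere area,
  which is the Green function of the Laplacian on the unit ball with pole at the centre.\<close>

definition radial_majorant :: "nat \<Rightarrow> real \<Rightarrow> real" where
  "radial_majorant n s = sqrt ((s powr (2 - real n) - 1) / ((real n - 2) * sphere_area n))"

lemma radial_majorant_measurable [measurable]: "radial_majorant n \<in> borel_measurable borel"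
  unfolding radial_majorant_def[abs_def] by measurable

lemma radial_majorant_nonneg:
  assumes "n \<ge> 3" "0 < s" "s \<le> 1" shows "0 \<le> radial_majorant n s"
proof -
  have "1 powr (2 - real n) \<le> s powr (2 - real n)" using assms by (intro powr_mono2') auto
  then show ?thesis
    using assms sphere_area_pos[of n] by (simp add: radial_majorant_def)
qed

lemma radial_majorant_le:
  assumes "n \<ge> 3" "0 < r" "r \<le> s" shows "radial_majorant n s \<le> radial_majorant n r"
proof -
  have "s powr (2 - real n) \<le> r powr (2 - real n)" using assms by (intro powr_mono2') auto
  then show ?thesis
    using assms sphere_area_pos[of n] by (simp add: radial_majorant_def divide_right_mono)
qed

text \<open>Cauchy-Schwarz splits the integrand into the gradient and |y|^(1-N) on s \<le> |y| \<le>
  1; the outer cut at 1 is free because the gradient vanishes beyond. By polar coordinates the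
  squared L2 norm of the second factor is the integral of \<open>sphere_area\<close> times
  \<sigma>^(1-N) over [s,1], which equals (\<open>sphere_area\<close> *
  \<open>radial_majorant\<close>)^2.\<close>

lemma nn_integral_grad_tail_le:
  fixes \<phi> :: "real^'n::finite \<Rightarrow> real"
  assumes n: "CARD('n) \<ge> 3" and \<phi>: "test_fun \<phi>" and s: "0 < s" "s \<le> 1" and G: "0 \<le> G"
    and le: "(\<integral>\<^sup>+y. ennreal ((norm (grad \<phi> y))\<^sup>2) \<partial>lborel) \<le> ennreal (G\<^sup>2)"
  shows "(\<integral>\<^sup>+y. ennreal (norm (grad \<phi> y) / norm y ^ (CARD('n) - 1)) * indicator {s..} (norm y) \<partial>lborel)
     \<le> ennreal (G * (sphere_area CARD('n) * radial_majorant CARD('n) s))"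
proof -
  let ?n = "CARD('n)" let ?k = "CARD('n) - 1"
  let ?S = "sphere_area ?n" let ?m = "radial_majorant ?n s"
  have S: "?S > 0" by (rule sphere_area_pos) simp
  have [measurable]: "grad \<phi> \<in> borel_measurable borel"
    using borel_measurable_test_fun[OF \<phi>] by simp
  let ?g = "\<lambda>\<sigma>. ennreal (1 / \<sigma> ^ ?k) * indicator {s..1} \<sigma>"
  have "(\<integral>\<^sup>+y. ennreal (norm (grad \<phi> y) / norm y ^ ?k) * indicator {s..} (norm y) \<partial>lborel)
      = (\<integral>\<^sup>+y. ennreal (norm (grad \<phi> y)) * ?g (norm y) \<partial>lborel)"
  proof (rule nn_integral_cong)
    fix y :: "real^'n"
    show "ennreal (norm (grad \<phi> y) / norm y ^ ?k) * indicator {s..} (norm y)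
        = ennreal (norm (grad \<phi> y)) * ?g (norm y)"
    proof (cases "norm y < 1")
      case True
      then show ?thesis by (auto simp: ennreal_mult[symmetric] split: split_indicator)
    next
      case False
      then have "grad \<phi> y = 0" by (intro test_fun_outside(2)[OF \<phi>]) (simp add: unit_ball_def)
      then show ?thesis by simp
    qed
  qed
  also have "\<dots> \<le> ennreal (G * (?S * ?m))"
  proof (rule nn_integral_mult_le_of_squares)
    show "(\<integral>\<^sup>+y. (ennreal (norm (grad \<phi> y)))\<^sup>2 \<partial>lborel) \<le> ennreal (G\<^sup>2)"
      using le by (simp add: ennreal_power)
    have "(\<integral>\<^sup>+y. (?g (norm (y::real^'n)))\<^sup>2 \<partial>lborel)
       = (\<integral>\<^sup>+\<sigma>. ennreal (?S * \<sigma> ^ ?k) * indicator {0..} \<sigma> * (?g \<sigma>)\<^sup>2 \<partial>lborel)"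
      using nn_integral_radial[of "\<lambda>\<sigma>. (?g \<sigma>)\<^sup>2", where 'a="real^'n"] by simp
    also have "\<dots> = (\<integral>\<^sup>+\<sigma>. ennreal (?S * \<sigma> powr (1 - real ?n)) * indicator {s..1} \<sigma> \<partial>lborel)"
    proof (rule nn_integral_cong)
      fix \<sigma> :: real
      show "ennreal (?S * \<sigma> ^ ?k) * indicator {0..} \<sigma> * (?g \<sigma>)\<^sup>2 = ennreal (?S * \<sigma> powr (1 - real ?n)) * indicator {s..1} \<sigma>"
      proof (cases "\<sigma> \<in> {s..1}")
        case True
        then have \<sigma>: "\<sigma> > 0" using s by auto
        have "\<sigma> powr (1 - real ?n) = 1 / \<sigma> powr (real ?n - 1)"
          using powr_minus[of \<sigma> "real ?n - 1"] by (simp add: divide_inverse)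
        also have "\<dots> = 1 / \<sigma> ^ ?k" using \<sigma> n by (simp add: powr_realpow[symmetric] of_nat_diff)
        finally have "?S * \<sigma> powr (1 - real ?n) = ?S * \<sigma> ^ ?k * (1 / \<sigma> ^ ?k)\<^sup>2"
          using \<sigma> by (simp add: power2_eq_square)
        then show ?thesis using True \<sigma> S s
          by (simp add: ennreal_power ennreal_mult[symmetric])
      qed auto
    qed
    also have "\<dots> = ennreal ((- (?S / (real ?n - 2)) * 1 powr (2 - real ?n)) - (- (?S / (real ?n - 2)) * s powr (2 - real ?n)))"
    proof (rule nn_integral_FTC_Icc)
      show "((\<lambda>\<sigma>. - (?S / (real ?n - 2)) * \<sigma> powr (2 - real ?n)) has_real_derivative ?S * \<sigma> powr (1 - real ?n)) (at \<sigma>)"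
        if "\<sigma> \<in> {s..1}" for \<sigma>
      proof -
        have "((\<lambda>\<sigma>. \<sigma> powr (2 - real ?n)) has_real_derivative (2 - real ?n) * \<sigma> powr (2 - real ?n - 1)) (at \<sigma>)"
          using that s by (intro has_real_derivative_powr) auto
        from DERIV_cmult[OF this, of "- (?S / (real ?n - 2))"]
        show ?thesis
        proof (rule DERIV_cong)
          show "- (?S / (real ?n - 2)) * ((2 - real ?n) * \<sigma> powr (2 - real ?n - 1)) = ?S * \<sigma> powr (1 - real ?n)"
            using n by (simp add: divide_simps) (simp add: algebra_simps)
        qed
      qed
    qed (use s S in auto)
    also have "(- (?S / (real ?n - 2)) * 1 powr (2 - real ?n)) - (- (?S / (real ?n - 2)) * s powr (2 - real ?n)) = (?S * ?m)\<^sup>2"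
    proof -
      have "1 powr (2 - real ?n) \<le> s powr (2 - real ?n)" using s n by (intro powr_mono2') auto
      then have "?m\<^sup>2 = (s powr (2 - real ?n) - 1) / ((real ?n - 2) * ?S)"
        unfolding radial_majorant_def using S n by (intro real_sqrt_pow2) auto
      moreover have "- (S / d) * 1 - - (S / d) * P = S\<^sup>2 * ((P - 1) / (d * S))"
        if "S \<noteq> 0" "d \<noteq> 0" for S d P :: real
        using that by (simp add: field_simps power2_eq_square)
      ultimately show ?thesis
        using S n by (simp add: power_mult_distrib)
    qed
    finally show "(\<integral>\<^sup>+y. (?g (norm (y::real^'n)))\<^sup>2 \<partial>lborel) \<le> ennreal ((?S * ?m)\<^sup>2)" by simp
  qed (use G S radial_majorant_nonneg[OF n s] in auto)
  finally show ?thesis .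
qed

text \<open>The integral over s is turned back into one over space, so that both sides have the same
  weight and the same set of integration. For a radial function in place of \<phi>, the inequality
  then compares two integrands shell by shell.\<close>

lemma nn_integral_test_fun_shell_le_majorant:
  fixes \<phi> :: "real^'n::finite \<Rightarrow> real"
  assumes n: "CARD('n) \<ge> 3" and \<phi>: "test_fun \<phi>" and r: "0 < r" "r < 1" and G: "0 \<le> G"
    and C[measurable]: "C \<in> sets borel" and Cr: "C \<subseteq> {r..1}"
    and le: "(\<integral>\<^sup>+y. ennreal ((norm (grad \<phi> y))\<^sup>2) \<partial>lborel) \<le> ennreal (G\<^sup>2)"
  shows "(\<integral>\<^sup>+x. ennreal (\<bar>\<phi> x\<bar> / norm x ^ (CARD('n) - 1)) * indicator C (norm x) \<partial>lborel)
     \<le> ennreal G * (\<integral>\<^sup>+x. ennreal (radial_majorant CARD('n) (norm (x::real^'n)) / norm x ^ (CARD('n) - 1)) * indicator C (norm x) \<partial>lborel)"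
proof -
  let ?k = "CARD('n) - 1" let ?S = "sphere_area CARD('n)" let ?m = "radial_majorant CARD('n)"
  have S: "?S > 0" by (rule sphere_area_pos) simp
  have "(\<integral>\<^sup>+x. ennreal (\<bar>\<phi> x\<bar> / norm x ^ ?k) * indicator C (norm x) \<partial>lborel)
      \<le> (\<integral>\<^sup>+s. indicator C s *
          (\<integral>\<^sup>+y. ennreal (norm (grad \<phi> y) / norm y ^ ?k) * indicator {s..} (norm y) \<partial>lborel) \<partial>lborel)"
    by (rule nn_integral_test_fun_shell_le[OF \<phi> r C]) (use Cr in auto)
  also have "\<dots> \<le> (\<integral>\<^sup>+s. indicator C s * ennreal (G * (?S * ?m s)) \<partial>lborel)"
  proof (rule nn_integral_mono)
    fix s
    show "indicator C s * (\<integral>\<^sup>+y. ennreal (norm (grad \<phi> y) / norm y ^ ?k) * indicator {s..} (norm y) \<partial>lborel)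
       \<le> indicator C s * ennreal (G * (?S * ?m s))"
    proof (cases "s \<in> C")
      case True
      then have "0 < s" "s \<le> 1" using Cr r by auto
      then show ?thesis by (intro mult_left_mono nn_integral_grad_tail_le[OF n \<phi> _ _ G le]) auto
    qed auto
  qed
  also have "\<dots> = (\<integral>\<^sup>+s. ennreal G * (ennreal (?S * s ^ ?k) * indicator {0..} s * (ennreal (?m s / s ^ ?k) * indicator C s)) \<partial>lborel)"
  proof (rule nn_integral_cong)
    fix s
    show "indicator C s * ennreal (G * (?S * ?m s)) = ennreal G * (ennreal (?S * s ^ ?k) * indicator {0..} s * (ennreal (?m s / s ^ ?k) * indicator C s))"
    proof (cases "s \<in> C")
      case True
      then have s: "0 < s" "s \<le> 1" using Cr r by auto
      then have "0 \<le> ?m s" using radial_majorant_nonneg[OF n] by simp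
      then show ?thesis using True s S G
        by (simp add: ennreal_mult[symmetric])
    qed auto
  qed
  also have "\<dots> = ennreal G * (\<integral>\<^sup>+s. ennreal (?S * s ^ ?k) * indicator {0..} s * (ennreal (?m s / s ^ ?k) * indicator C s) \<partial>lborel)"
    by (rule nn_integral_cmult) measurable
  also have "(\<integral>\<^sup>+s. ennreal (?S * s ^ ?k) * indicator {0..} s * (ennreal (?m s / s ^ ?k) * indicator C s) \<partial>lborel)
     = (\<integral>\<^sup>+x. ennreal (?m (norm (x::real^'n)) / norm x ^ ?k) * indicator C (norm x) \<partial>lborel)"
    using nn_integral_radial[of "\<lambda>s. ennreal (?m s / s ^ ?k) * indicator C s", where 'a="real^'n"] by simp
  finally show ?thesis .
qed

section \<open>Pointwise bound for radial functions\<close>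

text \<open>Since C stays away from 0, the weight |x|^(1-N) is bounded on the shells and has a
  finite L2 norm Q, so the L2 error of the approximation controls the weighted one. Finiteness of M
  later permits subtracting the two sides.\<close>

lemma nn_integral_H10_shell_le_majorant:
  fixes u :: "real^'n::finite \<Rightarrow> real"
  assumes n: "CARD('n) \<ge> 3" and H: "H10 u g" and r: "0 < r" "r < 1" and G: "0 \<le> G"
    and C[measurable]: "C \<in> sets borel" and Cr: "C \<subseteq> {r..1}"
    and le: "(\<integral>\<^sup>+y. ennreal ((norm (g y))\<^sup>2) \<partial>lebesgue) \<le> ennreal (G\<^sup>2)"
  defines "M \<equiv> (\<integral>\<^sup>+x. ennreal (radial_majorant CARD('n) (norm (x::real^'n)) / norm x ^ (CARD('n) - 1)) * indicator C (norm x) \<partial>lborel)"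
  shows "M < \<infinity>"
    and "(\<integral>\<^sup>+x. ennreal (\<bar>u x\<bar> / norm x ^ (CARD('n) - 1)) * indicator C (norm x) \<partial>lebesgue) \<le> ennreal G * M"
proof -
  let ?k = "CARD('n) - 1" let ?m = "radial_majorant CARD('n)"
  obtain \<phi> where \<phi>: "\<And>k. test_fun (\<phi> k)"
      "(\<lambda>k. \<integral>\<^sup>+ x. ennreal ((\<phi> k x - u x)\<^sup>2) \<partial>lebesgue) \<longlonglongrightarrow> 0"
      "(\<lambda>k. \<integral>\<^sup>+ x. ennreal ((norm (grad (\<phi> k) x - g x))\<^sup>2) \<partial>lebesgue) \<longlonglongrightarrow> 0"
    and u[measurable]: "u \<in> borel_measurable lebesgue" and g[measurable]: "g \<in> borel_measurable lebesgue"
    using H unfolding H10_def by auto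
  have \<phi>b[measurable]: "\<phi> k \<in> borel_measurable borel" "grad (\<phi> k) \<in> borel_measurable borel" for k
    using borel_measurable_test_fun[OF \<phi>(1)[of k]] by auto
  have \<phi>m[measurable]: "\<phi> k \<in> borel_measurable lebesgue" "grad (\<phi> k) \<in> borel_measurable lebesgue" for k
    using \<phi>b by (auto intro!: measurable_completion)
  let ?w = "\<lambda>x::real^'n. ennreal (1 / norm x ^ ?k) * indicator C (norm x)"
  have wm[measurable]: "?w \<in> borel_measurable lebesgue"
    by (intro measurable_completion) measurable
  have w_le: "?w x \<le> ennreal (1 / r ^ ?k) * indicator (cball 0 1) x" for x
  proof (cases "norm x \<in> C")
    case True
    then have x: "r \<le> norm x" "norm x \<le> 1" using Cr by auto
    have "1 / norm x ^ ?k \<le> 1 / r ^ ?k"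
      using x r by (intro divide_left_mono power_mono mult_pos_pos zero_less_power) auto
    then show ?thesis using True x by (simp add: ennreal_leI)
  qed auto
  have vol: "emeasure lborel (cball 0 1 :: (real^'n) set) < \<infinity>"
    by (rule emeasure_lborel_cball_finite)
  show M: "M < \<infinity>"
  proof -
    have "M \<le> (\<integral>\<^sup>+x. ennreal (?m r / r ^ ?k) * indicator (cball 0 1) (x::real^'n) \<partial>lborel)"
      unfolding M_def
    proof (rule nn_integral_mono)
      fix x :: "real^'n"
      show "ennreal (?m (norm x) / norm x ^ ?k) * indicator C (norm x) \<le> ennreal (?m r / r ^ ?k) * indicator (cball 0 1) x"
      proof (cases "norm x \<in> C")
        case True
        then have x: "r \<le> norm x" "norm x \<le> 1" using Cr by auto
        have "?m (norm x) / norm x ^ ?k \<le> ?m r / r ^ ?k"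
          using x r radial_majorant_le[OF n r(1) x(1)] radial_majorant_nonneg[OF n]
          by (intro frac_le power_mono zero_less_power) auto
        then show ?thesis using True x by (simp add: ennreal_leI)
      qed auto
    qed
    also have "\<dots> = ennreal (?m r / r ^ ?k) * emeasure lborel (cball 0 1 :: (real^'n) set)"
      by (rule nn_integral_cmult_indicator) simp
    also have "\<dots> < \<infinity>" using vol by (simp add: ennreal_mult_less_top)
    finally show ?thesis .
  qed
  have "\<exists>Q\<ge>0. (\<integral>\<^sup>+x. (?w x)\<^sup>2 \<partial>lebesgue) \<le> ennreal (Q\<^sup>2)"
  proof -
    have "(\<integral>\<^sup>+x. (?w x)\<^sup>2 \<partial>lebesgue) \<le> (\<integral>\<^sup>+x. (ennreal (1 / r ^ ?k))\<^sup>2 * indicator (cball 0 1) (x::real^'n) \<partial>lborel)"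
      unfolding nn_integral_completion
    proof (rule nn_integral_mono)
      fix x :: "real^'n"
      have "(?w x)\<^sup>2 \<le> (ennreal (1 / r ^ ?k) * indicator (cball 0 1) x)\<^sup>2"
        by (rule power_mono[OF w_le]) simp
      also have "\<dots> = (ennreal (1 / r ^ ?k))\<^sup>2 * indicator (cball 0 1) x"
        by (auto split: split_indicator)
      finally show "(?w x)\<^sup>2 \<le> \<dots>" .
    qed
    also have "\<dots> = (ennreal (1 / r ^ ?k))\<^sup>2 * emeasure lborel (cball 0 1 :: (real^'n) set)"
      by (rule nn_integral_cmult_indicator) simp
    also have "\<dots> < \<infinity>" using vol r by (simp add: ennreal_mult_less_top ennreal_power)
    finally obtain q where "q \<ge> 0" "(\<integral>\<^sup>+x. (?w x)\<^sup>2 \<partial>lebesgue) = ennreal q"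
      by (cases "(\<integral>\<^sup>+x. (?w x)\<^sup>2 \<partial>lebesgue)" rule: ennreal_cases) auto
    then show ?thesis by (intro exI[of _ "sqrt q"]) auto
  qed
  then obtain Q where Q: "Q \<ge> 0" "(\<integral>\<^sup>+x. (?w x)\<^sup>2 \<partial>lebesgue) \<le> ennreal (Q\<^sup>2)" by blast
  obtain m where m: "m \<ge> 0" "M = ennreal m"
    using M by (cases M rule: ennreal_cases) auto
  let ?L = "\<integral>\<^sup>+x. ennreal (\<bar>u x\<bar> / norm x ^ ?k) * indicator C (norm x) \<partial>lebesgue"
  \<comment> \<open>Choose k so that both L2 errors are below e. The gradient of \<phi> k then has
    norm at most G + e, and replacing u by \<phi> k costs at most e Q.\<close>
  have bound: "?L \<le> ennreal ((G + e) * m + e * Q)" if e: "e > 0" for e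
  proof -
    have e2: "ennreal (e\<^sup>2) > 0" using e by simp
    have "\<forall>\<^sub>F k in sequentially. (\<integral>\<^sup>+ x. ennreal ((\<phi> k x - u x)\<^sup>2) \<partial>lebesgue) < ennreal (e\<^sup>2) \<and>
       (\<integral>\<^sup>+ x. ennreal ((norm (grad (\<phi> k) x - g x))\<^sup>2) \<partial>lebesgue) < ennreal (e\<^sup>2)"
      using order_tendstoD(2)[OF \<phi>(2) e2] order_tendstoD(2)[OF \<phi>(3) e2] by eventually_elim auto
    then obtain k where k: "(\<integral>\<^sup>+ x. ennreal ((\<phi> k x - u x)\<^sup>2) \<partial>lebesgue) < ennreal (e\<^sup>2)"
       "(\<integral>\<^sup>+ x. ennreal ((norm (grad (\<phi> k) x - g x))\<^sup>2) \<partial>lebesgue) < ennreal (e\<^sup>2)"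
      by (auto simp: eventually_sequentially)
    have "(\<integral>\<^sup>+ x. ennreal ((norm (grad (\<phi> k) x))\<^sup>2) \<partial>lebesgue)
       \<le> (\<integral>\<^sup>+ x. (ennreal (norm (g x)) + ennreal (norm (grad (\<phi> k) x - g x)))\<^sup>2 \<partial>lebesgue)"
    proof (rule nn_integral_mono)
      fix x
      have "norm (grad (\<phi> k) x) \<le> norm (g x) + norm (grad (\<phi> k) x - g x)"
        using norm_triangle_ineq[of "g x" "grad (\<phi> k) x - g x"] by simp
      then have "ennreal ((norm (grad (\<phi> k) x))\<^sup>2) \<le> ennreal ((norm (g x) + norm (grad (\<phi> k) x - g x))\<^sup>2)"
        by (intro ennreal_leI power_mono) auto
      then show "ennreal ((norm (grad (\<phi> k) x))\<^sup>2) \<le> (ennreal (norm (g x)) + ennreal (norm (grad (\<phi> k) x - g x)))\<^sup>2"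
        by (simp add: ennreal_power ennreal_plus[symmetric] del: ennreal_plus)
    qed
    also have "\<dots> \<le> ennreal ((G + e)\<^sup>2)"
      by (rule nn_integral_add_square_le) (use le k G e in \<open>auto simp: ennreal_power\<close>)
    finally have grad_le: "(\<integral>\<^sup>+ x. ennreal ((norm (grad (\<phi> k) x))\<^sup>2) \<partial>lborel) \<le> ennreal ((G + e)\<^sup>2)"
      by (simp add: nn_integral_completion)
    have "?L \<le> (\<integral>\<^sup>+x. ennreal (\<bar>\<phi> k x\<bar> / norm x ^ ?k) * indicator C (norm x) + ennreal \<bar>\<phi> k x - u x\<bar> * ?w x \<partial>lebesgue)"
    proof (rule nn_integral_mono)
      fix x
      have "\<bar>u x\<bar> / norm x ^ ?k \<le> (\<bar>\<phi> k x\<bar> + \<bar>\<phi> k x - u x\<bar>) / norm x ^ ?k"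
        by (intro divide_right_mono) auto
      then have "ennreal (\<bar>u x\<bar> / norm x ^ ?k) \<le> ennreal (\<bar>\<phi> k x\<bar> / norm x ^ ?k + \<bar>\<phi> k x - u x\<bar> * (1 / norm x ^ ?k))"
        by (intro ennreal_leI) (simp add: add_divide_distrib)
      then show "ennreal (\<bar>u x\<bar> / norm x ^ ?k) * indicator C (norm x)
         \<le> ennreal (\<bar>\<phi> k x\<bar> / norm x ^ ?k) * indicator C (norm x) + ennreal \<bar>\<phi> k x - u x\<bar> * ?w x"
        by (simp add: ennreal_mult[symmetric] split: split_indicator)
    qed
    also have "\<dots> = (\<integral>\<^sup>+x. ennreal (\<bar>\<phi> k x\<bar> / norm x ^ ?k) * indicator C (norm x) \<partial>lebesgue) + (\<integral>\<^sup>+x. ennreal \<bar>\<phi> k x - u x\<bar> * ?w x \<partial>lebesgue)"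
      by (rule nn_integral_add) (measurable; auto intro!: measurable_completion)+
    also have "\<dots> \<le> ennreal (G + e) * M + ennreal (e * Q)"
    proof (rule add_mono)
      show "(\<integral>\<^sup>+x. ennreal (\<bar>\<phi> k x\<bar> / norm x ^ ?k) * indicator C (norm x) \<partial>lebesgue) \<le> ennreal (G + e) * M"
        unfolding M_def nn_integral_completion
        by (rule nn_integral_test_fun_shell_le_majorant[OF n \<phi>(1) r _ C Cr grad_le]) (use G e in auto)
      show "(\<integral>\<^sup>+x. ennreal \<bar>\<phi> k x - u x\<bar> * ?w x \<partial>lebesgue) \<le> ennreal (e * Q)"
      proof (rule nn_integral_mult_le_of_squares[OF _ wm _ Q(2) _ Q(1)])
        show "(\<integral>\<^sup>+x. (ennreal \<bar>\<phi> k x - u x\<bar>)\<^sup>2 \<partial>lebesgue) \<le> ennreal (e\<^sup>2)"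
          using k by (simp add: ennreal_power)
      qed (use e in auto)
    qed
    also have "\<dots> = ennreal ((G + e) * m + e * Q)"
      using G e m Q by (simp add: ennreal_mult[symmetric] ennreal_plus[symmetric] del: ennreal_plus)
    finally show ?thesis .
  qed
  have "(\<lambda>i. ennreal ((G + inverse (real (Suc i))) * m + inverse (real (Suc i)) * Q)) \<longlonglongrightarrow> ennreal ((G + 0) * m + 0 * Q)"
    by (intro tendsto_ennrealI tendsto_intros LIMSEQ_inverse_real_of_nat)
  then have "?L \<le> ennreal ((G + 0) * m + 0 * Q)"
    by (rule LIMSEQ_le_const) (use bound in auto)
  then show "?L \<le> ennreal G * M"
    using G m by (simp add: ennreal_mult)
qed

text \<open>
  The profile f of a radial function need not be measurable. If the bound fails on a set of positive
  measure, that set contains a non-null compact set, whose image under the norm is a Borel set on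
  which the shell inequality can be tested.
\<close>
lemma radial_H10_pointwise_bound:
  fixes u :: "real^'n::finite \<Rightarrow> real"
  assumes n: "CARD('n) \<ge> 3" and H: "H10 u g" and rad: "radial_fun u" and G: "0 \<le> G"
    and le: "(\<integral>\<^sup>+y. ennreal ((norm (g y))\<^sup>2) \<partial>lebesgue) \<le> ennreal (G\<^sup>2)"
  shows "AE x in lebesgue. x \<in> unit_ball \<longrightarrow> \<bar>u x\<bar> \<le> G * radial_majorant CARD('n) (norm x)"
proof -
  let ?k = "CARD('n) - 1" let ?m = "radial_majorant CARD('n)"
  obtain f where f: "AE x in lebesgue. u x = f (norm x)" using rad by (auto simp: radial_fun_def)
  have u[measurable]: "u \<in> borel_measurable lebesgue" using H by (simp add: H10_def)
  \<comment> \<open>The composite agrees almost everywhere with the measurable u, and Lebesgue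
    measure is complete.\<close>
  have fm[measurable]: "(\<lambda>x::real^'n. f (norm x)) \<in> borel_measurable lebesgue"
    by (rule borel_measurable_AE[OF u f])
  have mm[measurable]: "(\<lambda>x::real^'n. ?m (norm x)) \<in> borel_measurable lebesgue"
    by (intro measurable_completion) measurable
  have nm[measurable]: "(\<lambda>x::real^'n. norm x) \<in> borel_measurable lebesgue"
    by (intro measurable_completion) measurable
  have key: "negligible {x::real^'n. r \<le> norm x \<and> norm x \<le> 1 \<and> G * ?m (norm x) < \<bar>f (norm x)\<bar>}"
    if r: "0 < r" "r < 1" for r
  proof -
    define E where "E = {x::real^'n. r \<le> norm x \<and> norm x \<le> 1 \<and> G * ?m (norm x) < \<bar>f (norm x)\<bar>}"
    have "E = {x \<in> space lebesgue. r \<le> norm x \<and> norm x \<le> 1 \<and> G * ?m (norm x) < \<bar>f (norm x)\<bar>}"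
      by (simp add: E_def)
    also have "\<dots> \<in> sets lebesgue" by measurable
    finally have "E \<in> sets lebesgue" .
    then obtain K D where K: "negligible K" and D: "\<And>i::nat. compact (D i)" and E: "E = (\<Union>i. D i) \<union> K"
      using lebesgue_regular_inner by blast
    have "negligible (D i)" for i
    proof -
      define C where "C = norm ` D i"
      have "compact C" unfolding C_def by (intro compact_continuous_image continuous_intros D)
      then have C[measurable]: "C \<in> sets borel" by (rule borel_compact)
      have "D i \<subseteq> E" using E by blast
      then have Cr: "C \<subseteq> {r..1}" and Cf: "\<And>s. s \<in> C \<Longrightarrow> G * ?m s < \<bar>f s\<bar>"
        by (auto simp: C_def E_def)
      have indm[measurable]: "(\<lambda>x::real^'n. indicator C (norm x) :: ennreal) \<in> borel_measurable lebesgue"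
        by (intro measurable_completion) measurable
      note shell = nn_integral_H10_shell_le_majorant[OF n H r G C Cr le]
      let ?h1 = "\<lambda>x::real^'n. ennreal G * (ennreal (?m (norm x) / norm x ^ ?k) * indicator C (norm x))"
      let ?h2 = "\<lambda>x::real^'n. ennreal (\<bar>u x\<bar> / norm x ^ ?k) * indicator C (norm x)"
      have h1: "(\<integral>\<^sup>+x. ?h1 x \<partial>lebesgue) = ennreal G * (\<integral>\<^sup>+x. ennreal (?m (norm (x::real^'n)) / norm x ^ ?k) * indicator C (norm x) \<partial>lborel)"
        unfolding nn_integral_completion by (rule nn_integral_cmult) measurable
      have h1_fin: "(\<integral>\<^sup>+x. ?h1 x \<partial>lebesgue) < \<infinity>"
        unfolding h1 using shell(1) by (simp add: ennreal_mult_less_top)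
      have h21: "(\<integral>\<^sup>+x. ?h2 x \<partial>lebesgue) \<le> (\<integral>\<^sup>+x. ?h1 x \<partial>lebesgue)"
        unfolding h1 by (rule shell(2))
      have lt: "AE x in lebesgue. norm x \<in> C \<longrightarrow> ?h1 x < ?h2 x"
        using f
      proof eventually_elim
        case (elim x)
        show ?case
        proof
          assume xC: "norm x \<in> C"
          then have x: "0 < norm x" "norm x \<le> 1" using Cr r by auto
          have "0 \<le> ?m (norm x)" using radial_majorant_nonneg[OF n] x by simp
          moreover have "G * ?m (norm x) / norm x ^ ?k < \<bar>u x\<bar> / norm x ^ ?k"
            using Cf[OF xC] elim x by (intro divide_strict_right_mono) auto
          ultimately show "?h1 x < ?h2 x"
            using xC G x by (simp add: ennreal_mult[symmetric] ennreal_less_iff)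
        qed
      qed
      then have "AE x in lebesgue. ?h1 x \<le> ?h2 x"
        by eventually_elim (auto split: split_indicator)
      \<comment> \<open>\<open>?h2\<close> exceeds \<open>?h1\<close> strictly where |x| lies in C,
        yet its integral is not larger and the integral of \<open>?h1\<close> is finite. Hence the
        points with |x| in C form a null set.\<close>
      then have "(\<integral>\<^sup>+x. ?h2 x - ?h1 x \<partial>lebesgue) = (\<integral>\<^sup>+x. ?h2 x \<partial>lebesgue) - (\<integral>\<^sup>+x. ?h1 x \<partial>lebesgue)"
        using h1_fin by (intro nn_integral_diff) auto
      also have "\<dots> = 0" using h21 h1_fin by (intro diff_eq_0_ennreal) auto
      finally have "AE x in lebesgue. ?h2 x - ?h1 x = 0"
        by (subst (asm) nn_integral_0_iff_AE) auto
      with lt have "AE x in lebesgue. norm (x::real^'n) \<notin> C"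
        by eventually_elim (auto simp: diff_eq_0_iff_ennreal)
      then have "negligible {x::real^'n. norm x \<in> C}"
        unfolding eventually_ae_filter_negligible using negligible_subset by auto
      moreover have "D i \<subseteq> {x. norm x \<in> C}" by (auto simp: C_def)
      ultimately show ?thesis by (rule negligible_subset)
    qed
    then have "negligible E" unfolding E using K by (intro negligible_Un negligible_countable_Union) auto
    then show ?thesis by (simp add: E_def)
  qed
  \<comment> \<open>The radii start at 1/2, since \<open>key\<close> demands r < 1; together with
    the null set {0} these shells exhaust the ball.\<close>
  have "negligible (\<Union>i::nat. {x::real^'n. 1 / (real i + 2) \<le> norm x \<and> norm x \<le> 1 \<and> G * ?m (norm x) < \<bar>f (norm x)\<bar>})"
    by (intro negligible_countable_Union) (auto intro!: key)
  then have "negligible ((\<Union>i::nat. {x::real^'n. 1 / (real i + 2) \<le> norm x \<and> norm x \<le> 1 \<and> G * ?m (norm x) < \<bar>f (norm x)\<bar>}) \<union> {0})" (is "negligible ?N")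
    by (intro negligible_Un) auto
  then have "AE x in lebesgue. x \<notin> ?N"
    unfolding eventually_ae_filter_negligible by blast
  with f show ?thesis
  proof eventually_elim
    case (elim x)
    show ?case
    proof (rule impI, rule ccontr)
      assume x: "x \<in> unit_ball" and c: "\<not> \<bar>u x\<bar> \<le> G * ?m (norm x)"
      have x0: "norm x > 0" "norm x \<le> 1" using elim x by (auto simp: unit_ball_def)
      then obtain i where "inverse (real (Suc i)) < norm x" using reals_Archimedean by blast
      moreover have "1 / (real i + 2) \<le> inverse (real (Suc i))" by (simp add: field_simps)
      ultimately have "1 / (real i + 2) \<le> norm x" by linarith
      with x0 c elim(1) have "x \<in> ?N" by auto
      with elim show False by blast
    qed
  qed
qed

section \<open>The weight\<close>

lemma nn_integral_Gamma_scaled: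
  fixes a c :: real
  assumes a: "a > 0" and c: "c > 0"
  shows "(\<integral>\<^sup>+s. ennreal (s powr (a - 1) * exp (- c * s)) * indicator {0..} s \<partial>lborel) = ennreal (Gamma a * c powr (- a))"
proof -
  let ?f = "\<lambda>t. ennreal (indicator {0..} t * t powr (a - 1) / exp t)"
  have "ennreal (Gamma a) = (\<integral>\<^sup>+t. ?f t \<partial>lborel)"
    using Gamma_conv_nn_integral_real[OF a] by simp
  also have "\<dots> = ennreal \<bar>c\<bar> * (\<integral>\<^sup>+s. ?f (0 + c * s) \<partial>lborel)"
    by (rule nn_integral_real_affine) (use c in auto)
  also have "(\<integral>\<^sup>+s. ?f (0 + c * s) \<partial>lborel)
     = (\<integral>\<^sup>+s. ennreal (c powr (a - 1)) * (ennreal (s powr (a - 1) * exp (- c * s)) * indicator {0..} s) \<partial>lborel)"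
    using c by (intro nn_integral_cong)
      (auto simp: powr_mult ennreal_mult[symmetric] exp_minus divide_inverse mult_ac zero_le_mult_iff split: split_indicator)
  also have "\<dots> = ennreal (c powr (a - 1)) * (\<integral>\<^sup>+s. ennreal (s powr (a - 1) * exp (- c * s)) * indicator {0..} s \<partial>lborel)"
    by (rule nn_integral_cmult) measurable
  finally have eq: "ennreal (Gamma a) = ennreal (c powr a) * (\<integral>\<^sup>+s. ennreal (s powr (a - 1) * exp (- c * s)) * indicator {0..} s \<partial>lborel)" (is "_ = _ * ?I")
    using c by (simp add: mult.assoc[symmetric] ennreal_mult[symmetric] powr_diff)
  have "?I = ennreal (c powr (- a)) * (ennreal (c powr a) * ?I)"
    using c by (simp add: mult.assoc[symmetric] ennreal_mult[symmetric] powr_minus)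
  also have "\<dots> = ennreal (Gamma a * c powr (- a))"
    unfolding eq[symmetric] using a by (simp add: ennreal_mult[symmetric] mult.commute)
  finally show ?thesis .
qed

section \<open>Bounds on the weight and its integral against the radial majorant\<close>

lemma Vw_measurable [measurable]: "Vw R \<alpha> \<in> borel_measurable borel"
  unfolding Vw_def[abs_def] by measurable

lemma Vw_bounds:
  assumes "0 \<le> R" "R < 1" "\<alpha> > 0" "0 \<le> r" "r < 1"
  shows "0 \<le> Vw R \<alpha> r" "Vw R \<alpha> r \<le> 1"
proof -
  show "0 \<le> Vw R \<alpha> r" by (simp add: Vw_def)
  show "Vw R \<alpha> r \<le> 1"
    using assms by (auto simp: Vw_def field_simps intro!: powr_le1)
qed

lemma Vw_pos:
  assumes "0 \<le> R" "R < 1" "0 < r" "r < 1" "r \<noteq> R"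
  shows "0 < Vw R \<alpha> r"
  using assms by (auto simp: Vw_def field_simps)

text \<open>This is 1 - y \<le> exp(-y) with y = r/R, raised to the power \<alpha>. The rate
  \<alpha>/R is the source of the factor R^a in the comparison of constants.\<close>

lemma Vw_le_inner:
  assumes "0 < r" "r < R" "R < 1" "\<alpha> > 0"
  shows "Vw R \<alpha> r \<le> exp (- (\<alpha> / R) * r)"
proof -
  have "1 - r / R \<le> exp (- (r / R))" using exp_ge_add_one_self[of "- (r / R)"] by simp
  then have "(1 - r / R) powr \<alpha> \<le> exp (- (r / R)) powr \<alpha>"
    using assms by (intro powr_mono2) auto
  also have "\<dots> = exp (- (\<alpha> / R) * r)" by (simp add: powr_def)
  finally show ?thesis using assms by (simp add: Vw_def)
qed

text \<open>Because 1 - R is at most 1, the base of the power, 1 - (1 - r)/(1 - R), is at most 1 -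
  (1 - r) = r.\<close>

lemma Vw_le_outer:
  assumes "0 < r" "R \<le> r" "r < 1" "0 \<le> R" "\<alpha> > 0"
  shows "Vw R \<alpha> r \<le> r powr \<alpha>"
proof (cases "R = 0")
  case False
  have "1 - (1 - r) / (1 - R) \<le> r"
    using assms by (simp add: field_simps) (metis mult_left_mono mult.right_neutral less_imp_le add.commute diff_ge_0_iff_ge distrib_left mult_nonneg_nonneg)
  moreover have "0 \<le> 1 - (1 - r) / (1 - R)" using assms by (simp add: field_simps)
  ultimately show ?thesis using assms False by (auto simp: Vw_def intro!: powr_mono2)
qed (simp add: Vw_def)

text \<open>For s < R the -1 is dropped and the powers of s collect to q(2 - n) + n - 1 = a - 1,
  which gives a Gamma integrand. For s \<ge> R the -1 has to be kept, since it provides the factor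
  (1 - s)^q and thereby the faster decay in \<alpha>.\<close>

lemma Vw_integrand_le:
  fixes n :: nat and p R \<alpha> s :: real
  assumes n: "n \<ge> 3" and p: "p > 1" and R: "0 \<le> R" "R < 1" and \<alpha>: "\<alpha> > 1" and s: "0 < s" "s < 1"
  defines "q \<equiv> (p + 1) / 2" and "a \<equiv> real n - (p + 1) * (real n - 2) / 2"
  assumes a: "a > 0"
  shows "Vw R \<alpha> s * (s powr (2 - real n) - 1) powr q * s powr (real n - 1) \<le>
    (if R = 0 then 0 else s powr (a - 1) * exp (- (\<alpha> / R) * s)) +
    (real n - 2) powr q * ((1 - s) powr q * exp (- (\<alpha> - 1) * (1 - s)))"
proof -
  have q: "q > 0" using p by (simp add: q_def)
  have s1: "1 powr (2 - real n) \<le> s powr (2 - real n)" using s n by (intro powr_mono2') auto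
  then have nn: "0 \<le> s powr (2 - real n) - 1" by simp
  have expo: "(s powr (2 - real n)) powr q * s powr (real n - 1) = s powr (a - 1)"
    using s by (simp add: powr_powr powr_add[symmetric] a_def q_def field_simps)
  show ?thesis
  proof (cases "s < R")
    case True
    then have R0: "R \<noteq> 0" using s by auto
    have "(s powr (2 - real n) - 1) powr q \<le> (s powr (2 - real n)) powr q"
      using nn q by (intro powr_mono2) auto
    then have "(s powr (2 - real n) - 1) powr q * s powr (real n - 1) \<le> s powr (a - 1)"
      unfolding expo[symmetric] by (rule mult_right_mono) simp
    then have "Vw R \<alpha> s * ((s powr (2 - real n) - 1) powr q * s powr (real n - 1)) \<le> exp (- (\<alpha> / R) * s) * s powr (a - 1)"
      using Vw_le_inner[of s R \<alpha>] Vw_bounds(1)[of R \<alpha> s] True R s \<alpha> by (intro mult_mono) auto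
    moreover have "0 \<le> (real n - 2) powr q * ((1 - s) powr q * exp (- (\<alpha> - 1) * (1 - s)))" by simp
    ultimately have "Vw R \<alpha> s * ((s powr (2 - real n) - 1) powr q * s powr (real n - 1)) \<le> exp (- (\<alpha> / R) * s) * s powr (a - 1) +
        (real n - 2) powr q * ((1 - s) powr q * exp (- (\<alpha> - 1) * (1 - s)))" by linarith
    then show ?thesis using R0 by (simp add: mult_ac)
  next
    case False
    \<comment> \<open>Bernoulli gives s^(n-2) \<ge> 1 - (n-2)(1-s), which is then multiplied by
      s^(2-n). The bound keeps the linear vanishing at s = 1.\<close>
    have "s powr (2 - real n) - 1 \<le> (real n - 2) * (1 - s) * s powr (2 - real n)"
    proof -
      have "1 - real (n - 2) * (1 - s) \<le> s ^ (n - 2)"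
        using Bernoulli_inequality[of "s - 1" "n - 2"] s by (simp add: algebra_simps)
      then have B: "1 - (real n - 2) * (1 - s) \<le> s powr (real n - 2)"
        using s n by (simp add: powr_realpow[symmetric] of_nat_diff)
      have "s powr (2 - real n) * (1 - (real n - 2) * (1 - s)) \<le> s powr (2 - real n) * s powr (real n - 2)"
        by (rule mult_left_mono[OF B]) simp
      also have "\<dots> = 1" using s by (simp add: powr_add[symmetric])
      finally show ?thesis by (simp add: algebra_simps)
    qed
    then have "(s powr (2 - real n) - 1) powr q \<le> ((real n - 2) * (1 - s) * s powr (2 - real n)) powr q"
      using nn q by (intro powr_mono2) auto
    also have "\<dots> = (real n - 2) powr q * (1 - s) powr q * (s powr (2 - real n)) powr q"
      using n s by (simp add: powr_mult)
    finally have "(s powr (2 - real n) - 1) powr q * s powr (real n - 1) \<le>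
        (real n - 2) powr q * (1 - s) powr q * (s powr (2 - real n)) powr q * s powr (real n - 1)"
      by (rule mult_right_mono) simp
    also have "\<dots> = (real n - 2) powr q * (1 - s) powr q * s powr (a - 1)"
      unfolding expo[symmetric] by (simp add: mult_ac)
    finally have B: "(s powr (2 - real n) - 1) powr q * s powr (real n - 1) \<le> (real n - 2) powr q * (1 - s) powr q * s powr (a - 1)" .
    have "Vw R \<alpha> s * ((s powr (2 - real n) - 1) powr q * s powr (real n - 1)) \<le>
        s powr \<alpha> * ((real n - 2) powr q * (1 - s) powr q * s powr (a - 1))"
      using Vw_le_outer[of s R \<alpha>] False R s \<alpha> by (intro mult_mono[OF _ B]) auto
    also have "\<dots> = (real n - 2) powr q * (1 - s) powr q * s powr (\<alpha> + a - 1)"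
      by (simp add: powr_add[symmetric] mult_ac add_diff_eq)
    also have "\<dots> \<le> (real n - 2) powr q * (1 - s) powr q * exp (- (\<alpha> - 1) * (1 - s))"
    proof (rule mult_left_mono)
      have "s powr (\<alpha> + a - 1) \<le> s powr (\<alpha> - 1)" using s a by (intro powr_mono') auto
      also have "\<dots> \<le> exp (- (1 - s)) powr (\<alpha> - 1)"
        using exp_ge_add_one_self[of "- (1 - s)"] s \<alpha> by (intro powr_mono2) auto
      also have "\<dots> = exp (- (\<alpha> - 1) * (1 - s))" by (simp add: powr_def algebra_simps)
      finally show "s powr (\<alpha> + a - 1) \<le> exp (- (\<alpha> - 1) * (1 - s))" .
    qed simp
    finally have "Vw R \<alpha> s * ((s powr (2 - real n) - 1) powr q * s powr (real n - 1)) \<le>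
        (real n - 2) powr q * (1 - s) powr q * exp (- (\<alpha> - 1) * (1 - s))" .
    moreover have "0 \<le> (if R = 0 then 0 else s powr (a - 1) * exp (- (\<alpha> / R) * s))" by simp
    ultimately show ?thesis unfolding mult.assoc by linarith
  qed
qed

text \<open>Both majorants are integrated over a half line, the second after the reflection s -> 1 -
  s, and become Gamma integrals. The first term, of order \<alpha>^(-a), is the leading one when R >
  0; for R = 0 it is absent.\<close>

lemma nn_integral_Vw_le:
  fixes n :: nat and p R \<alpha> :: real
  assumes n: "n \<ge> 3" and p: "p > 1" and R: "0 \<le> R" "R < 1" and \<alpha>: "\<alpha> > 1"
  defines "q \<equiv> (p + 1) / 2" and "a \<equiv> real n - (p + 1) * (real n - 2) / 2"
  assumes a: "a > 0"
  shows "(\<integral>\<^sup>+s. ennreal (Vw R \<alpha> s * (s powr (2 - real n) - 1) powr q * s powr (real n - 1)) * indicator {0<..<1} s \<partial>lborel)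
    \<le> ennreal (Gamma a * R powr a * \<alpha> powr (- a) + (real n - 2) powr q * Gamma (q + 1) * (\<alpha> - 1) powr (- (q + 1)))"
proof -
  let ?f1 = "\<lambda>s. ennreal (if R = 0 then 0 else s powr (a - 1) * exp (- (\<alpha> / R) * s)) * indicator {0..} s"
  let ?f2 = "\<lambda>s. ennreal ((1 - s) powr q * exp (- (\<alpha> - 1) * (1 - s))) * indicator {0..} (1 - s)"
  have q: "q > 0" using p by (simp add: q_def)
  have "(\<integral>\<^sup>+s. ennreal (Vw R \<alpha> s * (s powr (2 - real n) - 1) powr q * s powr (real n - 1)) * indicator {0<..<1} s \<partial>lborel)
    \<le> (\<integral>\<^sup>+s. ?f1 s + ennreal ((real n - 2) powr q) * ?f2 s \<partial>lborel)"
  proof (rule nn_integral_mono)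
    fix s :: real
    show "ennreal (Vw R \<alpha> s * (s powr (2 - real n) - 1) powr q * s powr (real n - 1)) * indicator {0<..<1} s
       \<le> ?f1 s + ennreal ((real n - 2) powr q) * ?f2 s"
    proof (cases "s \<in> {0<..<1}")
      case True
      then have s: "0 < s" "s < 1" by auto
      have "ennreal (Vw R \<alpha> s * (s powr (2 - real n) - 1) powr q * s powr (real n - 1))
          \<le> ennreal ((if R = 0 then 0 else s powr (a - 1) * exp (- (\<alpha> / R) * s)) +
            (real n - 2) powr q * ((1 - s) powr q * exp (- (\<alpha> - 1) * (1 - s))))"
        using Vw_integrand_le[OF n p R \<alpha> s] a unfolding a_def q_def by (intro ennreal_leI) auto
      also have "\<dots> = ?f1 s + ennreal ((real n - 2) powr q) * ?f2 s"
        using s by (subst ennreal_plus) (auto simp: ennreal_mult)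
      finally show ?thesis using True by simp
    qed auto
  qed
  also have "\<dots> = (\<integral>\<^sup>+s. ?f1 s \<partial>lborel) + ennreal ((real n - 2) powr q) * (\<integral>\<^sup>+s. ?f2 s \<partial>lborel)"
    by (subst nn_integral_add) (auto simp: nn_integral_cmult)
  also have "(\<integral>\<^sup>+s. ?f1 s \<partial>lborel) = ennreal (Gamma a * R powr a * \<alpha> powr (- a))"
  proof (cases "R = 0")
    case False
    then have "(\<integral>\<^sup>+s. ?f1 s \<partial>lborel) = ennreal (Gamma a * (\<alpha> / R) powr (- a))"
      using nn_integral_Gamma_scaled[OF a, of "\<alpha> / R"] R \<alpha> by simp
    also have "(\<alpha> / R) powr (- a) = R powr a * \<alpha> powr (- a)"
      using R \<alpha> False by (simp add: powr_divide powr_minus field_simps)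
    finally show ?thesis by (simp add: mult.assoc)
  qed simp
  also have "(\<integral>\<^sup>+s. ?f2 s \<partial>lborel) = ennreal (Gamma (q + 1) * (\<alpha> - 1) powr (- (q + 1)))"
  proof -
    have "(\<integral>\<^sup>+s. ennreal (s powr (q + 1 - 1) * exp (- (\<alpha> - 1) * s)) * indicator {0..} s \<partial>lborel)
       = ennreal \<bar>-1\<bar> * (\<integral>\<^sup>+s. ennreal ((1 + (-1) * s) powr (q + 1 - 1) * exp (- (\<alpha> - 1) * (1 + (-1) * s))) * indicator {0..} (1 + (-1) * s) \<partial>lborel)"
      by (rule nn_integral_real_affine) auto
    then show ?thesis using nn_integral_Gamma_scaled[of "q + 1" "\<alpha> - 1"] q \<alpha> by simp
  qed
  also have "ennreal (Gamma a * R powr a * \<alpha> powr (- a)) + ennreal ((real n - 2) powr q) * ennreal (Gamma (q + 1) * (\<alpha> - 1) powr (- (q + 1)))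
     = ennreal (Gamma a * R powr a * \<alpha> powr (- a) + (real n - 2) powr q * Gamma (q + 1) * (\<alpha> - 1) powr (- (q + 1)))"
    using a q by (subst ennreal_plus) (auto simp: ennreal_mult[symmetric] mult.assoc)
  finally show ?thesis .
qed

section \<open>Bounds for the infima\<close>

lemma H10_nn_integral_grad:
  assumes H: "H10 u g" and I: "set_integrable lebesgue unit_ball (\<lambda>x. (norm (g x))\<^sup>2)"
  shows "(\<integral>\<^sup>+x. ennreal ((norm (g x))\<^sup>2) \<partial>lebesgue) = ennreal (\<integral>x\<in>unit_ball. (norm (g x))\<^sup>2 \<partial>lebesgue)"
proof -
  have [measurable]: "g \<in> borel_measurable lebesgue" using H by (simp add: H10_def)
  have "AE x in lebesgue. indicat_real unit_ball x *\<^sub>R (norm (g x))\<^sup>2 = (norm (g x))\<^sup>2"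
    using H10_outside[OF H] by eventually_elim (auto split: split_indicator)
  then have "integrable lebesgue (\<lambda>x. (norm (g x))\<^sup>2)"
    using I unfolding set_integrable_def by (subst (asm) integrable_cong_AE) auto
  then show ?thesis
    unfolding H10_integral_grad[OF H] by (intro nn_integral_eq_integral) auto
qed

text \<open>The weight is at most 1, which transfers integrability. Inside the ball it can vanish
  only on the sphere of radius R or at the origin, a null set, so a nonzero u has a positive
  weighted integral.\<close>

lemma weighted_integral_pos:
  fixes u :: "real^'n::finite \<Rightarrow> real"
  assumes H: "H10 u g" and nz: "nonzero_fun u" and p: "p > 1" and R: "0 \<le> R" "R < 1" and \<alpha>: "\<alpha> > 0"
    and I: "set_integrable lebesgue unit_ball (\<lambda>x. \<bar>u x\<bar> powr (p + 1))"
  shows "set_integrable lebesgue unit_ball (\<lambda>x. Vw R \<alpha> (norm x) * \<bar>u x\<bar> powr (p + 1))"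
    and "(\<integral>x\<in>unit_ball. Vw R \<alpha> (norm x) * \<bar>u x\<bar> powr (p + 1) \<partial>lebesgue) > 0"
proof -
  have u[measurable]: "u \<in> borel_measurable lebesgue" using H by (simp add: H10_def)
  have Vm[measurable]: "(\<lambda>x::real^'n. Vw R \<alpha> (norm x)) \<in> borel_measurable lebesgue"
    by (intro measurable_completion) simp
  have V: "0 \<le> Vw R \<alpha> (norm x)" "Vw R \<alpha> (norm x) \<le> 1" if "x \<in> unit_ball" for x :: "real^'n"
    using Vw_bounds[OF R \<alpha>, of "norm x"] that by (auto simp: unit_ball_def)
  let ?F = "\<lambda>x. indicat_real unit_ball x * (Vw R \<alpha> (norm x) * \<bar>u x\<bar> powr (p + 1))"
  have Fi: "integrable lebesgue ?F"
    using I unfolding set_integrable_def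
    by (rule Bochner_Integration.integrable_bound)
       (auto intro!: AE_I2 mult_left_le_one_le simp: V abs_mult split: split_indicator)
  then show "set_integrable lebesgue unit_ball (\<lambda>x. Vw R \<alpha> (norm x) * \<bar>u x\<bar> powr (p + 1))"
    by (simp add: set_integrable_def)
  have F0: "0 \<le> ?F x" for x using V[of x] by (auto split: split_indicator)
  have "(\<integral>x. ?F x \<partial>lebesgue) \<noteq> 0"
  proof
    assume "(\<integral>x. ?F x \<partial>lebesgue) = 0"
    then have F_ae: "AE x in lebesgue. ?F x = 0"
      using integral_nonneg_eq_0_iff_AE[OF Fi] F0 by auto
    have "negligible (sphere (0::real^'n) R \<union> {0})"
      by (intro negligible_Un negligible_sphere) auto
    then have "AE x in lebesgue. x \<notin> sphere (0::real^'n) R \<union> {0}"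
      unfolding eventually_ae_filter_negligible by blast
    with F_ae H10_outside[OF H] have "AE x in lebesgue. u x = 0"
    proof eventually_elim
      case (elim x)
      show ?case
      proof (cases "x \<in> unit_ball")
        case True
        then have "0 < Vw R \<alpha> (norm x)"
          using elim by (intro Vw_pos[OF R]) (auto simp: unit_ball_def)
        with elim True show ?thesis by simp
      qed (use elim in simp)
    qed
    with nz show False by (simp add: nonzero_fun_def)
  qed
  moreover have "(\<integral>x. ?F x \<partial>lebesgue) \<ge> 0" using F0 by (intro integral_nonneg_AE) auto
  ultimately show "(\<integral>x\<in>unit_ball. Vw R \<alpha> (norm x) * \<bar>u x\<bar> powr (p + 1) \<partial>lebesgue) > 0"
    by (simp add: set_lebesgue_integral_def)
qed

text \<open>This identifies the first two factors of \<open>K_const\<close>: the exponent (1-p)/2 of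
  the sphere area is -(p+1)/2 from the majorant plus 1 from the polar density.\<close>

lemma radial_majorant_powr:
  assumes n: "n \<ge> 3" and s: "0 < s" "s < 1" and A: "0 \<le> A" and p: "p > 1"
  shows "(sqrt A * radial_majorant n s) powr (p + 1) * sphere_area n =
    A powr ((p + 1) / 2) * ((real n - 2) powr (- (p + 1) / 2) * sphere_area n powr ((1 - p) / 2)) *
    (s powr (2 - real n) - 1) powr ((p + 1) / 2)"
proof -
  let ?q = "(p + 1) / 2" and ?S = "sphere_area n" and ?X = "s powr (2 - real n) - 1"
  have S: "?S > 0" using n by (intro sphere_area_pos) auto
  have "1 powr (2 - real n) \<le> s powr (2 - real n)" using s n by (intro powr_mono2') auto
  then have X: "0 \<le> ?X" by simp
  have sq: "sqrt y powr (p + 1) = y powr ?q" if "0 \<le> y" for y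
    using that by (simp add: powr_half_sqrt[symmetric] powr_powr)
  have "sqrt A * radial_majorant n s = sqrt (A * (?X / ((real n - 2) * ?S)))"
    unfolding radial_majorant_def real_sqrt_mult[symmetric] ..
  then have "(sqrt A * radial_majorant n s) powr (p + 1) = (A * (?X / ((real n - 2) * ?S))) powr ?q"
    using A X S n by (simp add: sq)
  also have "\<dots> = A powr ?q * (?X powr ?q / ((real n - 2) powr ?q * ?S powr ?q))"
    using A X S n by (simp only: powr_mult powr_divide)
  also have "\<dots> = A powr ?q * ?X powr ?q * ((real n - 2) powr (- ?q) * ?S powr (- ?q))"
    unfolding powr_minus_divide by simp
  finally have 1: "(sqrt A * radial_majorant n s) powr (p + 1) = A powr ?q * ?X powr ?q * ((real n - 2) powr (- ?q) * ?S powr (- ?q))" .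
  have 2: "?S powr (- ?q) * ?S = ?S powr ((1 - p) / 2)"
  proof -
    have "?S powr (- ?q) * ?S = ?S powr (- ?q) * ?S powr 1" using S by simp
    also have "\<dots> = ?S powr ((1 - p) / 2)" unfolding powr_add[symmetric] by (simp add: field_simps)
    finally show ?thesis .
  qed
  have "(sqrt A * radial_majorant n s) powr (p + 1) * ?S = A powr ?q * ?X powr ?q * ((real n - 2) powr (- ?q) * (?S powr (- ?q) * ?S))"
    unfolding 1 by (simp add: mult_ac)
  then have "(sqrt A * radial_majorant n s) powr (p + 1) * ?S = A powr ?q * ?X powr ?q * ((real n - 2) powr (- ?q) * ?S powr ((1 - p) / 2))"
    unfolding 2 .
  then show ?thesis unfolding minus_divide_left by (simp only: mult_ac)
qed

text \<open>With A the energy, the pointwise bound makes the weighted integral at most A^((p+1)/2)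
  times a constant times j. The power 2/(p+1) turns the first factor into A, which cancels against
  the numerator.\<close>

lemma rayleigh_radial_lower_bound:
  fixes u :: "real^'n::finite \<Rightarrow> real"
  defines "n \<equiv> CARD('n)"
  assumes n: "n \<ge> 3" and H: "H10 u g" and nz: "nonzero_fun u" and rad: "radial_fun u"
    and p: "p > 1" and R: "0 \<le> R" "R < 1" and \<alpha>: "\<alpha> > 0"
    and pos: "rayleigh (\<lambda>_. 1) p u g > 0"
    and J: "(\<integral>\<^sup>+s. ennreal (Vw R \<alpha> s * (s powr (2 - real n) - 1) powr ((p + 1) / 2) * s powr (real n - 1)) * indicator {0<..<1} s \<partial>lborel) \<le> ennreal j"
    and j: "j > 0"
  shows "((real n - 2) powr (- (p + 1) / 2) * sphere_area n powr ((1 - p) / 2) * j) powr (- 2 / (p + 1)) \<le> rayleigh (Vw R \<alpha>) p u g"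
proof -
  let ?\<kappa> = "(real n - 2) powr (- (p + 1) / 2) * sphere_area n powr ((1 - p) / 2)"
  let ?q = "(p + 1) / 2"
  have S: "sphere_area n > 0" unfolding n_def by (intro sphere_area_pos) auto
  have \<kappa>: "?\<kappa> > 0" using n S by simp
  define A where "A = (\<integral>x\<in>unit_ball. (norm (g x))\<^sup>2 \<partial>lebesgue)"
  define D where "D = (\<integral>x\<in>unit_ball. Vw R \<alpha> (norm x) * \<bar>u x\<bar> powr (p + 1) \<partial>lebesgue)"
  have ui: "set_integrable lebesgue unit_ball (\<lambda>x. \<bar>u x\<bar> powr (p + 1))"
    using rayleigh_pos_imp_integrable(1)[OF pos] by simp
  have D: "D > 0" unfolding D_def by (rule weighted_integral_pos(2)[OF H nz p R \<alpha> ui])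
  have "A \<ge> 0" unfolding A_def set_lebesgue_integral_def by auto
  moreover have "A \<noteq> 0" using pos by (auto simp: rayleigh_def A_def)
  ultimately have A: "A > 0" by simp
  have grad: "(\<integral>\<^sup>+y. ennreal ((norm (g y))\<^sup>2) \<partial>lebesgue) \<le> ennreal ((sqrt A)\<^sup>2)"
    using H10_nn_integral_grad[OF H rayleigh_pos_imp_integrable(2)[OF pos]] A by (simp add: A_def)
  have pw: "AE x in lebesgue. x \<in> unit_ball \<longrightarrow> \<bar>u x\<bar> \<le> sqrt A * radial_majorant n (norm x)"
    unfolding n_def using radial_H10_pointwise_bound[OF _ H rad _ grad] n A by (simp add: n_def)
  let ?F = "\<lambda>s. ennreal (Vw R \<alpha> s * (sqrt A * radial_majorant n s) powr (p + 1)) * indicator {0<..<1} s"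
  have "negligible {0::real^'n}" by simp
  then have ne0: "AE x in lebesgue. x \<notin> {0::real^'n}"
    unfolding eventually_ae_filter_negligible by blast
  have "ennreal D = (\<integral>\<^sup>+x. ennreal (indicat_real unit_ball x * (Vw R \<alpha> (norm x) * \<bar>u x\<bar> powr (p + 1))) \<partial>lebesgue)"
  proof -
    have "AE x in lebesgue. 0 \<le> indicat_real unit_ball x * (Vw R \<alpha> (norm x) * \<bar>u x\<bar> powr (p + 1))"
      using Vw_bounds(1)[OF R \<alpha>] by (auto intro!: AE_I2 simp: unit_ball_def split: split_indicator)
    from nn_integral_eq_integral[OF _ this] show ?thesis
      using weighted_integral_pos(1)[OF H nz p R \<alpha> ui] by (simp add: D_def set_lebesgue_integral_def set_integrable_def)
  qed
  also have "\<dots> \<le> (\<integral>\<^sup>+x. ?F (norm (x::real^'n)) \<partial>lebesgue)"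
  proof (rule nn_integral_mono_AE)
    show "AE x in lebesgue. ennreal (indicat_real unit_ball x * (Vw R \<alpha> (norm x) * \<bar>u x\<bar> powr (p + 1))) \<le> ?F (norm x)"
      using pw ne0
    proof eventually_elim
      case (elim x)
      show ?case
      proof (cases "x \<in> unit_ball")
        case True
        then have x: "0 < norm x" "norm x < 1" using elim by (auto simp: unit_ball_def)
        have "\<bar>u x\<bar> powr (p + 1) \<le> (sqrt A * radial_majorant n (norm x)) powr (p + 1)"
          using elim True p by (intro powr_mono2) auto
        then have "Vw R \<alpha> (norm x) * \<bar>u x\<bar> powr (p + 1) \<le> Vw R \<alpha> (norm x) * (sqrt A * radial_majorant n (norm x)) powr (p + 1)"
          using Vw_bounds(1)[OF R \<alpha>, of "norm x"] x by (intro mult_left_mono) auto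
        then show ?thesis using True x by (simp add: ennreal_leI)
      qed auto
    qed
  qed
  also have "\<dots> = (\<integral>\<^sup>+s. ennreal (sphere_area n * s ^ (n - 1)) * indicator {0..} s * ?F s \<partial>lborel)"
    unfolding nn_integral_completion
    using nn_integral_radial[of ?F, where 'a="real^'n"] by (simp add: n_def)
  also have "\<dots> = (\<integral>\<^sup>+s. ennreal (A powr ?q * ?\<kappa>) * (ennreal (Vw R \<alpha> s * (s powr (2 - real n) - 1) powr ?q * s powr (real n - 1)) * indicator {0<..<1} s) \<partial>lborel)"
  proof (rule nn_integral_cong)
    fix s :: real
    show "ennreal (sphere_area n * s ^ (n - 1)) * indicator {0..} s * ?F s =
      ennreal (A powr ?q * ?\<kappa>) * (ennreal (Vw R \<alpha> s * (s powr (2 - real n) - 1) powr ?q * s powr (real n - 1)) * indicator {0<..<1} s)"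
    proof (cases "s \<in> {0<..<1}")
      case True
      then have s: "0 < s" "s < 1" by auto
      have V: "0 \<le> Vw R \<alpha> s" using Vw_bounds(1)[OF R \<alpha>] s by simp
      have sn: "s ^ (n - 1) = s powr (real n - 1)"
        using s n by (simp add: powr_realpow[symmetric] of_nat_diff)
      have "(sphere_area n * s ^ (n - 1)) * (Vw R \<alpha> s * (sqrt A * radial_majorant n s) powr (p + 1))
         = Vw R \<alpha> s * s powr (real n - 1) * ((sqrt A * radial_majorant n s) powr (p + 1) * sphere_area n)"
        unfolding sn by (simp add: mult_ac)
      also have "\<dots> = (A powr ?q * ?\<kappa>) * (Vw R \<alpha> s * (s powr (2 - real n) - 1) powr ?q * s powr (real n - 1))"
        unfolding radial_majorant_powr[OF n s less_imp_le[OF A] p] by (simp only: mult_ac)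
      finally have *: "(sphere_area n * s ^ (n - 1)) * (Vw R \<alpha> s * (sqrt A * radial_majorant n s) powr (p + 1)) = \<dots>" .
      have "ennreal (sphere_area n * s ^ (n - 1)) * ennreal (Vw R \<alpha> s * (sqrt A * radial_majorant n s) powr (p + 1))
         = ennreal ((sphere_area n * s ^ (n - 1)) * (Vw R \<alpha> s * (sqrt A * radial_majorant n s) powr (p + 1)))"
        using S s V by (intro ennreal_mult[symmetric]) auto
      also have "\<dots> = ennreal (A powr ?q * ?\<kappa>) * ennreal (Vw R \<alpha> s * (s powr (2 - real n) - 1) powr ?q * s powr (real n - 1))"
        unfolding * using V \<kappa> by (intro ennreal_mult) auto
      finally have "ennreal (sphere_area n * s ^ (n - 1)) * ennreal (Vw R \<alpha> s * (sqrt A * radial_majorant n s) powr (p + 1)) = \<dots>" .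
      then show ?thesis using True s by simp
    qed auto
  qed
  also have "\<dots> = ennreal (A powr ?q * ?\<kappa>) * (\<integral>\<^sup>+s. ennreal (Vw R \<alpha> s * (s powr (2 - real n) - 1) powr ?q * s powr (real n - 1)) * indicator {0<..<1} s \<partial>lborel)"
    by (rule nn_integral_cmult) measurable
  also have "\<dots> \<le> ennreal (A powr ?q * ?\<kappa>) * ennreal j"
    by (intro mult_left_mono J) simp
  also have "\<dots> = ennreal (A powr ?q * (?\<kappa> * j))"
    using j \<kappa> by (simp add: ennreal_mult[symmetric] mult.assoc)
  finally have "D \<le> A powr ?q * (?\<kappa> * j)"
    using j \<kappa> by (subst (asm) ennreal_le_iff) auto
  then have "D powr (2 / (p + 1)) \<le> (A powr ?q * (?\<kappa> * j)) powr (2 / (p + 1))"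
    using D p by (intro powr_mono2) auto
  also have "\<dots> = A * (?\<kappa> * j) powr (2 / (p + 1))"
  proof -
    have e: "(p + 1) / 2 * (2 / (p + 1)) = 1" using p by simp
    have "(A powr ?q) powr (2 / (p + 1)) = A" unfolding powr_powr e using A by simp
    then show ?thesis by (simp only: powr_mult)
  qed
  finally have DA: "D powr (2 / (p + 1)) \<le> A * (?\<kappa> * j) powr (2 / (p + 1))" .
  have \<kappa>j: "?\<kappa> * j > 0" using \<kappa> j by simp
  have "(?\<kappa> * j) powr (- 2 / (p + 1)) = 1 / (?\<kappa> * j) powr (2 / (p + 1))"
    using powr_minus_divide[of "?\<kappa> * j" "2 / (p + 1)"] by simp
  also have "\<dots> \<le> A / D powr (2 / (p + 1))"
  proof -
    have frac: "1 / y \<le> A / x" if "x \<le> A * y" "0 < x" "0 < y" for x y :: real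
      using that by (simp add: field_simps)
    have "D powr (2 / (p + 1)) > 0" using D by simp
    moreover have "(?\<kappa> * j) powr (2 / (p + 1)) > 0"
      unfolding powr_gt_zero using \<kappa>j by (rule less_imp_neq[symmetric])
    ultimately show ?thesis by (rule frac[OF DA])
  qed
  finally show ?thesis by (simp add: rayleigh_def A_def D_def)
qed

section \<open>Comparing the two infima as \<alpha> tends to infinity\<close>

lemma rayleigh_nonneg: "0 \<le> rayleigh W p u g"
  unfolding rayleigh_def set_lebesgue_integral_def
  by (intro divide_nonneg_nonneg integral_nonneg_AE) auto

lemma S_alpha_le_rayleigh:
  fixes u :: "real^'n::finite \<Rightarrow> real"
  assumes "H10 u g" "nonzero_fun u"
  shows "S_alpha TYPE('n) p R \<alpha> \<le> rayleigh (Vw R \<alpha>) p u g"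
  unfolding S_alpha_def
  using assms by (intro cINF_lower2[of _ _ "(u, g)"]) (auto intro!: bdd_belowI2[of _ 0] rayleigh_nonneg)

lemma S_alpha_rad_le_rayleigh:
  fixes u :: "real^'n::finite \<Rightarrow> real"
  assumes "H10 u g" "nonzero_fun u" "radial_fun u"
  shows "S_alpha_rad TYPE('n) p R \<alpha> \<le> rayleigh (Vw R \<alpha>) p u g"
  unfolding S_alpha_rad_def
  using assms by (intro cINF_lower2[of _ _ "(u, g)"]) (auto intro!: bdd_belowI2[of _ 0] rayleigh_nonneg)

lemma S_sob_le_rayleigh:
  fixes u :: "real^'n::finite \<Rightarrow> real"
  assumes "H10 u g" "nonzero_fun u"
  shows "S_sob TYPE('n) p \<le> rayleigh (\<lambda>_. 1) p u g"
  unfolding S_sob_def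
  using assms by (intro cINF_lower2[of _ _ "(u, g)"]) (auto intro!: bdd_belowI2[of _ 0] rayleigh_nonneg)

lemma S_sob_nonneg: "0 \<le> S_sob TYPE('n::finite) p"
  unfolding S_sob_def
  using H10_test_fun[OF test_fun_radial_bump] nonzero_radial_bump
  by (intro cINF_greatest) (auto intro: rayleigh_nonneg)

lemma S_sob_approx:
  assumes "S_sob TYPE('n::finite) p < S'"
  obtains u :: "real^'n \<Rightarrow> real" and g where "H10 u g" "nonzero_fun u" "rayleigh (\<lambda>_. 1) p u g < S'"
proof -
  let ?X = "{(u :: real^'n \<Rightarrow> real, g). H10 u g \<and> nonzero_fun u}"
  have "?X \<noteq> {}"
    using H10_test_fun[OF test_fun_radial_bump] nonzero_radial_bump by auto
  then have "\<exists>ug\<in>?X. rayleigh (\<lambda>_. 1) p (fst ug) (snd ug) < S'"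
    using assms unfolding S_sob_def
    by (subst (asm) cINF_less_iff) (auto intro!: bdd_belowI2[of _ 0] rayleigh_nonneg)
  then show ?thesis using that by auto
qed

text \<open>Positivity of \<open>S_sob\<close> makes every quotient positive, as the lower bound for
  a single radial function requires. At R = 0 the positivity of j rests on its second term, the
  boundary contribution.\<close>

lemma S_alpha_rad_ge:
  fixes p R \<alpha> :: real
  defines "n \<equiv> CARD('n::finite)"
  defines "q \<equiv> (p + 1) / 2" and "a \<equiv> real n - (p + 1) * (real n - 2) / 2"
  assumes n: "n \<ge> 3" and p: "p > 1" and R: "0 \<le> R" "R < 1" and \<alpha>: "\<alpha> > 1" and a: "a > 0"
    and S: "S_sob TYPE('n) p > 0"
  defines "j \<equiv> Gamma a * R powr a * \<alpha> powr (- a) + (real n - 2) powr q * Gamma (q + 1) * (\<alpha> - 1) powr (- (q + 1))"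
  shows "j > 0" and
    "((real n - 2) powr (- (p + 1) / 2) * sphere_area n powr ((1 - p) / 2) * j) powr (- 2 / (p + 1))
      \<le> S_alpha_rad TYPE('n) p R \<alpha>"
proof -
  have q: "q > 0" using p by (simp add: q_def)
  show j: "j > 0"
    unfolding j_def using n a q \<alpha> by (intro add_nonneg_pos mult_nonneg_nonneg mult_pos_pos Gamma_real_pos less_imp_le[OF Gamma_real_pos]) auto
  show "((real n - 2) powr (- (p + 1) / 2) * sphere_area n powr ((1 - p) / 2) * j) powr (- 2 / (p + 1))
      \<le> S_alpha_rad TYPE('n) p R \<alpha>"
    unfolding S_alpha_rad_def
  proof (rule cINF_greatest)
    show "{(u :: real^'n \<Rightarrow> real, g). H10 u g \<and> nonzero_fun u \<and> radial_fun u} \<noteq> {}"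
      using H10_test_fun[OF test_fun_radial_bump] nonzero_radial_bump radial_radial_bump by blast
    fix ug :: "(real^'n \<Rightarrow> real) \<times> (real^'n \<Rightarrow> real^'n)"
    assume ug: "ug \<in> {(u, g). H10 u g \<and> nonzero_fun u \<and> radial_fun u}"
    then have H: "H10 (fst ug) (snd ug)" "nonzero_fun (fst ug)" "radial_fun (fst ug)" by auto
    show "((real n - 2) powr (- (p + 1) / 2) * sphere_area n powr ((1 - p) / 2) * j) powr (- 2 / (p + 1))
       \<le> rayleigh (Vw R \<alpha>) p (fst ug) (snd ug)"
      unfolding n_def
    proof (rule rayleigh_radial_lower_bound[OF _ H p R _ _ _ j])
      show "rayleigh (\<lambda>_. 1) p (fst ug) (snd ug) > 0"
        using S_sob_le_rayleigh[OF H(1,2), of p] S by linarith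
      show "(\<integral>\<^sup>+s. ennreal (Vw R \<alpha> s * (s powr (2 - real CARD('n)) - 1) powr ((p + 1) / 2) * s powr (real CARD('n) - 1)) * indicator {0<..<1} s \<partial>lborel) \<le> ennreal j"
        using nn_integral_Vw_le[OF n p R \<alpha>] a unfolding j_def q_def a_def n_def by simp
    qed (use n \<alpha> n_def in auto)
  qed
qed

text \<open>The centre c and the lower bound b of the weight are left free so that concentration at
  the origin and at the boundary are both instances. After division by \<alpha>^(a t) both bounds
  compare through limits, and \<open>cond\<close> is the strict inequality between these.\<close>

lemma eventually_S_alpha_less_S_alpha_rad:
  fixes p R \<beta> :: real and c :: "real \<Rightarrow> real^'n::finite" and b :: "real \<Rightarrow> real"
  assumes n: "CARD('n) \<ge> 3" and p: "p > 1" and R: "0 \<le> R" "R < 1"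
    and a: "real CARD('n) - (p + 1) * (real CARD('n) - 2) / 2 > 0"
    and S: "S_sob TYPE('n) p > 0"
    and c: "\<forall>\<^sub>F \<alpha> in at_top. ball (c \<alpha>) (1 / \<alpha>) \<subseteq> unit_ball"
    and b: "\<forall>\<^sub>F \<alpha> in at_top. \<forall>x\<in>ball (c \<alpha>) (1 / \<alpha>). b \<alpha> \<le> Vw R \<alpha> (norm x)"
    and b_lim: "(b \<longlongrightarrow> \<beta>) at_top" and \<beta>: "\<beta> > 0"
    and cond: "R powr (2 * real CARD('n) / (p + 1) - (real CARD('n) - 2)) * \<beta> powr (- 2 / (p + 1))
      < K_const CARD('n) p powr (- 2 / (p + 1)) / S_sob TYPE('n) p"
  shows "\<forall>\<^sub>F \<alpha> in at_top. S_alpha TYPE('n) p R \<alpha> < S_alpha_rad TYPE('n) p R \<alpha>"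
proof -
  define n where "n = CARD('n)"
  define q where "q = (p + 1) / 2"
  define a where "a = real n - (p + 1) * (real n - 2) / 2"
  define t where "t = 2 / (p + 1)"
  define \<kappa> where "\<kappa> = (real n - 2) powr (- (p + 1) / 2) * sphere_area n powr ((1 - p) / 2)"
  define S where "S = S_sob TYPE('n) p"
  have t: "t > 0" using p by (simp add: t_def)
  have a0: "a > 0" and n3: "n \<ge> 3" and S0: "S > 0" using a n S by (auto simp: a_def n_def S_def)
  have "sphere_area n > 0" using n3 by (intro sphere_area_pos) auto
  then have \<kappa>: "\<kappa> > 0" using n3 by (simp add: \<kappa>_def)
  have K: "K_const n p = \<kappa> * Gamma a" by (simp add: K_const_def \<kappa>_def a_def)
  have K0: "K_const n p > 0" using \<kappa> a0 by (simp add: K)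
  have e: "2 * real n / (p + 1) - (real n - 2) = a * t"
    using p by (simp add: a_def t_def field_simps)
  have mt: "- 2 / (p + 1) = - t" by (simp add: t_def)
  \<comment> \<open>The left side is the limit of the upper bound for \<open>S_alpha\<close> divided
    by the lower bound for \<open>S_alpha_rad\<close>, with the exact constant S.\<close>
  have cond': "(K_const n p * R powr a / \<beta>) powr t * S < 1"
  proof -
    have "R powr (a * t) * \<beta> powr (- t) < K_const n p powr (- t) / S"
      using cond unfolding n_def[symmetric] S_def[symmetric] e mt .
    then have "R powr (a * t) * \<beta> powr (- t) * S * K_const n p powr t < 1"
      using S0 K0 by (simp add: powr_minus field_simps)
    moreover have "(K_const n p * R powr a / \<beta>) powr t = K_const n p powr t * R powr (a * t) * \<beta> powr (- t)"
      by (simp only: powr_mult powr_divide powr_powr powr_minus_divide) simp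
    ultimately show ?thesis by (simp add: mult_ac)
  qed
  let ?L = "(K_const n p * R powr a / \<beta>) powr t"
  \<comment> \<open>No minimiser of \<open>S_sob\<close> is assumed to exist. The strict inequality
    leaves room for some S' > S, and a function with quotient below S' suffices.\<close>
  have "((\<lambda>s. ?L * s) \<longlongrightarrow> ?L * S) (at_right S)" by (intro tendsto_intros)
  then have "\<forall>\<^sub>F s in at_right S. ?L * s < 1"
    using cond' by (intro order_tendstoD(2)[of _ "?L * S"]) auto
  moreover have "\<forall>\<^sub>F s in at_right S. s > S" by (simp add: eventually_at_right_less)
  ultimately have "\<forall>\<^sub>F s in at_right S. ?L * s < 1 \<and> s > S" by eventually_elim auto
  then obtain S' where S': "?L * S' < 1" "S < S'"
    using eventually_happens'[OF trivial_limit_at_right_real] by blast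
  obtain u :: "real^'n \<Rightarrow> real" and g where u: "H10 u g" "nonzero_fun u" "rayleigh (\<lambda>_. 1) p u g < S'"
    using S_sob_approx S'(2) unfolding S_def by blast
  have u_pos: "rayleigh (\<lambda>_. 1) p u g > 0"
    using S_sob_le_rayleigh[OF u(1,2), of p] S0 by (simp add: S_def)
  define j where "j \<alpha> = Gamma a * R powr a * \<alpha> powr (- a) + (real n - 2) powr q * Gamma (q + 1) * (\<alpha> - 1) powr (- (q + 1))" for \<alpha>
  \<comment> \<open>The boundary contribution is negligible against \<alpha>^(-a): since q > 1, a =
    n - q(n-2) lies below 2, and q + 1 lies above 2.\<close>
  have lim0: "((\<lambda>\<alpha>. \<alpha> powr a * (\<alpha> - 1) powr (- (q + 1))) \<longlongrightarrow> 0) at_top"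
  proof (rule Lim_null_comparison)
    have aq: "a < q + 1"
    proof -
      have "(p + 1) * (real n - 2) > 2 * (real n - 2)" using p n3 by (intro mult_strict_right_mono) auto
      then show ?thesis using p by (simp add: a_def q_def field_simps)
    qed
    show "((\<lambda>\<alpha>. (1/2) powr (- (q + 1)) * \<alpha> powr (a - (q + 1))) \<longlongrightarrow> 0) at_top"
      using aq by (intro tendsto_mult_right_zero tendsto_neg_powr filterlim_ident) auto
    show "\<forall>\<^sub>F \<alpha> in at_top. norm (\<alpha> powr a * (\<alpha> - 1) powr (- (q + 1))) \<le> (1/2) powr (- (q + 1)) * \<alpha> powr (a - (q + 1))"
      using eventually_ge_at_top[of 2]
    proof eventually_elim
      case (elim \<alpha>)
      have "(\<alpha> - 1) powr (- (q + 1)) \<le> (1/2 * \<alpha>) powr (- (q + 1))"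
        using elim p by (intro powr_mono2') (auto simp: q_def)
      also have "\<dots> = (1/2) powr (- (q + 1)) * \<alpha> powr (- (q + 1))" by (rule powr_mult)
      finally have "\<alpha> powr a * (\<alpha> - 1) powr (- (q + 1)) \<le> \<alpha> powr a * ((1/2) powr (- (q + 1)) * \<alpha> powr (- (q + 1)))"
        by (rule mult_left_mono) simp
      also have "\<dots> = (1/2) powr (- (q + 1)) * (\<alpha> powr a * \<alpha> powr (- (q + 1)))" by (simp only: mult_ac)
      also have "\<alpha> powr a * \<alpha> powr (- (q + 1)) = \<alpha> powr (a - (q + 1))"
        unfolding powr_add[symmetric] by (simp add: algebra_simps)
      finally show ?case by simp
    qed
  qed
  have "((\<lambda>\<alpha>. \<kappa> * (Gamma a * R powr a + (real n - 2) powr q * Gamma (q + 1) * (\<alpha> powr a * (\<alpha> - 1) powr (- (q + 1)))) / b \<alpha>)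
      \<longlongrightarrow> \<kappa> * (Gamma a * R powr a + (real n - 2) powr q * Gamma (q + 1) * 0) / \<beta>) at_top"
    using \<beta> by (intro tendsto_intros lim0 b_lim) auto
  moreover have "\<forall>\<^sub>F \<alpha> in at_top. \<kappa> * (Gamma a * R powr a + (real n - 2) powr q * Gamma (q + 1) * (\<alpha> powr a * (\<alpha> - 1) powr (- (q + 1)))) / b \<alpha>
      = \<alpha> powr a * (\<kappa> * j \<alpha>) / b \<alpha>"
    using eventually_gt_at_top[of 0]
  proof eventually_elim
    case (elim \<alpha>)
    have "\<alpha> powr a * \<alpha> powr (- a) = 1" using elim by (simp add: powr_add[symmetric])
    then have "\<alpha> powr a * j \<alpha> = Gamma a * R powr a + (real n - 2) powr q * Gamma (q + 1) * (\<alpha> powr a * (\<alpha> - 1) powr (- (q + 1)))"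
      unfolding j_def distrib_left by (simp add: mult.left_commute mult.commute)
    then show ?case by (simp add: mult.left_commute)
  qed
  ultimately have X_lim: "((\<lambda>\<alpha>. \<alpha> powr a * (\<kappa> * j \<alpha>) / b \<alpha>) \<longlongrightarrow> K_const n p * R powr a / \<beta>) at_top"
    by (subst (asm) tendsto_cong) (auto simp: K mult.assoc)
  have b_pos: "\<forall>\<^sub>F \<alpha> in at_top. b \<alpha> > 0"
    using order_tendstoD(1)[OF b_lim \<beta>] .
  have j_pos: "j \<alpha> > 0" if "\<alpha> > 1" for \<alpha>
    using S_alpha_rad_ge(1)[where 'n='n, OF n p R that] a S unfolding j_def a_def q_def n_def by simp
  \<comment> \<open>For R = 0 the limit of this expression is 0, where passing to the limit in the
    power t relies on t > 0 and on eventual nonnegativity.\<close>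
  have X_nn: "\<forall>\<^sub>F \<alpha> in at_top. 0 \<le> \<alpha> powr a * (\<kappa> * j \<alpha>) / b \<alpha>"
    using b_pos eventually_gt_at_top[of 1]
    by eventually_elim (use j_pos \<kappa> in \<open>auto intro!: divide_nonneg_nonneg mult_nonneg_nonneg simp: less_imp_le\<close>)
  have "((\<lambda>\<alpha>. (\<alpha> powr a * (\<kappa> * j \<alpha>) / b \<alpha>) powr t * S') \<longlongrightarrow> ?L * S') at_top"
    by (intro tendsto_mult tendsto_const tendsto_powr'[OF X_lim]) (use X_nn t in auto)
  then have "\<forall>\<^sub>F \<alpha> in at_top. (\<alpha> powr a * (\<kappa> * j \<alpha>) / b \<alpha>) powr t * S' < 1"
    using S'(1) by (rule order_tendstoD(2))
  with b_pos c b eventually_gt_at_top[of 1] show ?thesis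
  proof eventually_elim
    case (elim \<alpha>)
    have \<alpha>: "\<alpha> > 1" "1 / \<alpha> > 0" using elim by auto
    obtain v :: "real^'n \<Rightarrow> real" and gv where v: "H10 v gv" "nonzero_fun v"
      "rayleigh (Vw R \<alpha>) p v gv \<le> (1 / \<alpha>) powr (real CARD('n) - 2 - 2 * real CARD('n) / (p + 1)) *
         b \<alpha> powr (- 2 / (p + 1)) * rayleigh (\<lambda>_. 1) p u g"
      by (rule rayleigh_rescale[OF u(1) p \<alpha>(2) elim(2) Vw_measurable[of R \<alpha>] _ _ elim(1) u_pos])
         (use elim Vw_bounds[OF R] in auto)
    have ex: "(1 / \<alpha>) powr (real CARD('n) - 2 - 2 * real CARD('n) / (p + 1)) = \<alpha> powr (a * t)"
    proof -
      have "real CARD('n) - 2 - 2 * real CARD('n) / (p + 1) = - (a * t)"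
        using e unfolding n_def by simp
      then show ?thesis using \<alpha> by (simp add: powr_divide powr_minus)
    qed
    have "S_alpha TYPE('n) p R \<alpha> \<le> \<alpha> powr (a * t) * b \<alpha> powr (- t) * rayleigh (\<lambda>_. 1) p u g"
      using S_alpha_le_rayleigh[OF v(1,2), of p R \<alpha>] v(3) unfolding ex mt by linarith
    also have "\<dots> < \<alpha> powr (a * t) * b \<alpha> powr (- t) * S'"
      using u(3) elim(1) \<alpha> by (intro mult_strict_left_mono) auto
    also have "\<dots> \<le> (\<kappa> * j \<alpha>) powr (- t)"
    proof -
      have kj: "\<kappa> * j \<alpha> > 0" using \<kappa> j_pos[OF \<alpha>(1)] by simp
      have "(\<alpha> powr a * (\<kappa> * j \<alpha>) / b \<alpha>) powr t = \<alpha> powr (a * t) * (\<kappa> * j \<alpha>) powr t * b \<alpha> powr (- t)"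
        by (simp only: powr_mult powr_divide powr_powr powr_minus_divide) simp
      then have "\<alpha> powr (a * t) * b \<alpha> powr (- t) * S' * (\<kappa> * j \<alpha>) powr t \<le> 1"
        using elim(5) by (simp add: mult_ac)
      then have "\<alpha> powr (a * t) * b \<alpha> powr (- t) * S' \<le> 1 / (\<kappa> * j \<alpha>) powr t"
        using kj by (subst pos_le_divide_eq) (simp_all only: powr_gt_zero less_imp_neq[symmetric] simp_thms)
      then show ?thesis by (simp only: powr_minus_divide)
    qed
    also have "\<dots> \<le> S_alpha_rad TYPE('n) p R \<alpha>"
      using S_alpha_rad_ge(2)[where 'n='n, OF n p R \<alpha>(1)] a S
      unfolding \<kappa>_def j_def a_def q_def n_def mt by simp
    finally show ?case .
  qed
qed

text \<open>The groundstate is a multiple of a minimiser v. If it were radial then so would v be,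
  provided the factor is nonzero, and v would compete in \<open>S_alpha_rad\<close>. The
  normalisation to 1 makes v nonzero, and positivity of \<open>S_sob\<close> makes the factor
  nonzero.\<close>

lemma groundstate_not_radial:
  fixes u :: "real^'n::finite \<Rightarrow> real"
  assumes S: "S_sob TYPE('n) p > 0" and less: "S_alpha TYPE('n) p R \<alpha> < S_alpha_rad TYPE('n) p R \<alpha>"
    and u: "groundstate p R \<alpha> u"
  shows "\<not> radial_fun u"
proof
  assume "radial_fun u"
  then obtain f where f: "AE x in lebesgue. u x = f (norm x)" by (auto simp: radial_fun_def)
  let ?s = "S_alpha TYPE('n) p R \<alpha>"
  obtain v g where v: "H10 v g" "(\<integral>x\<in>unit_ball. Vw R \<alpha> (norm x) * \<bar>v x\<bar> powr (p + 1) \<partial>lebesgue) = 1"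
     "rayleigh (Vw R \<alpha>) p v g = ?s" "u = (\<lambda>x. ?s powr (1 / (p - 1)) * v x)"
    using u by (auto simp: groundstate_def)
  have nz: "nonzero_fun v"
    unfolding nonzero_fun_def
  proof
    assume "AE x in lebesgue. v x = 0"
    then have "AE x in lebesgue. indicat_real unit_ball x *\<^sub>R (Vw R \<alpha> (norm x) * \<bar>v x\<bar> powr (p + 1)) = 0"
      by eventually_elim auto
    then show False using v(2) unfolding set_lebesgue_integral_def
      by (simp add: integral_eq_zero_AE)
  qed
  have "rayleigh (\<lambda>_. 1) p v g > 0" using S_sob_le_rayleigh[OF v(1) nz, of p] S by linarith
  then have "(\<integral>x\<in>unit_ball. (norm (g x))\<^sup>2 \<partial>lebesgue) \<noteq> 0" by (auto simp: rayleigh_def)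
  then have "?s \<noteq> 0" using v(2,3) by (auto simp: rayleigh_def)
  then have "?s powr (1 / (p - 1)) \<noteq> 0" by simp
  with f v(4) have "AE x in lebesgue. v x = f (norm x) / ?s powr (1 / (p - 1))"
    by (auto elim!: eventually_mono simp: field_simps)
  then have "radial_fun v"
    unfolding radial_fun_def by (intro exI[of _ "\<lambda>r. f r / ?s powr (1 / (p - 1))"])
  from S_alpha_rad_le_rayleigh[OF v(1) nz this, of p R \<alpha>] v(3) less show False by simp
qed

theorem mainTheorem2:
  fixes p R :: real
  assumes N3: "CARD('n::finite) \<ge> 3"
    and p_gt: "1 < p"
    and p_lt: "p < (real CARD('n) + 2) / (real CARD('n) - 2)"
    and R_ge: "0 \<le> R" and R_lt: "R < 1"
    and R_cond: "R powr (2 * real CARD('n) / (p + 1) - (real CARD('n) - 2)) *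
        (if R = 0 then exp (4 / ((1 - R) * (p + 1)))
         else min (exp (4 / (R * (p + 1)))) (exp (4 / ((1 - R) * (p + 1)))))
      < K_const CARD('n) p powr (- 2 / (p + 1)) / S_sob TYPE('n) p"
  shows "\<exists>\<alpha>0 > 0. \<forall>\<alpha> > \<alpha>0.
           S_alpha TYPE('n) p R \<alpha> < S_alpha_rad TYPE('n) p R \<alpha> \<and>
           (\<forall>u :: real^'n \<Rightarrow> real. groundstate p R \<alpha> u \<longrightarrow> \<not> radial_fun u)"
proof -
  let ?RHS = "K_const CARD('n) p powr (- 2 / (p + 1)) / S_sob TYPE('n) p"
  let ?e = "2 * real CARD('n) / (p + 1) - (real CARD('n) - 2)"
  have "0 < ?RHS"
    by (rule le_less_trans[OF _ R_cond]) (auto simp: min_def)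
  then have S: "S_sob TYPE('n) p > 0"
    using S_sob_nonneg[where 'n='n, of p] by (cases "S_sob TYPE('n) p = 0") auto
  have a: "real CARD('n) - (p + 1) * (real CARD('n) - 2) / 2 > 0"
    using p_lt N3 by (simp add: field_simps)
  have expo: "exp (- y) powr (- 2 / (p + 1)) = exp (2 * y / (p + 1))" for y
    by (simp add: powr_def)
  have "\<forall>\<^sub>F \<alpha> in at_top. S_alpha TYPE('n) p R \<alpha> < S_alpha_rad TYPE('n) p R \<alpha>"
  \<comment> \<open>The split is by which exponential attains the minimum: concentration at the
    origin for the first, at the boundary for the second. R = 0 falls under the second, matching the
    convention of an infinite first term.\<close>
  proof (cases "R \<noteq> 0 \<and> exp (4 / (R * (p + 1))) \<le> exp (4 / ((1 - R) * (p + 1)))")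
    case True
    then have R0: "R > 0" using R_ge by auto
    let ?b = "\<lambda>\<alpha>. (1 + (- 1 / R) / \<alpha>) powr \<alpha>"
    show ?thesis
    proof (rule eventually_S_alpha_less_S_alpha_rad[OF N3 p_gt R_ge R_lt a S, of "\<lambda>_. 0" ?b "exp (- (1 / R))"])
      show "\<forall>\<^sub>F \<alpha> in at_top. ball (0::real^'n) (1 / \<alpha>) \<subseteq> unit_ball"
        using eventually_gt_at_top[of 1] by eventually_elim (auto simp: unit_ball_def intro!: subset_ball)
      show "\<forall>\<^sub>F \<alpha> in at_top. \<forall>x\<in>ball (0::real^'n) (1 / \<alpha>). ?b \<alpha> \<le> Vw R \<alpha> (norm x)"
        using eventually_gt_at_top[of "1 / R"] eventually_gt_at_top[of 1]
      proof eventually_elim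
        case (elim \<alpha>)
        have \<alpha>: "1 / \<alpha> < R" using elim R0 by (simp add: field_simps)
        show ?case
        proof
          fix x :: "real^'n" assume "x \<in> ball 0 (1 / \<alpha>)"
          then have x: "norm x < 1 / \<alpha>" by simp
          have "1 - 1 / \<alpha> / R \<le> 1 - norm x / R"
            using x R0 by (intro diff_left_mono divide_right_mono) auto
          moreover have "0 \<le> 1 - 1 / \<alpha> / R" using \<alpha> R0 by (simp only: diff_ge_0_iff_ge pos_divide_le_eq)
          ultimately have "(1 - 1 / \<alpha> / R) powr \<alpha> \<le> (1 - norm x / R) powr \<alpha>"
            using elim by (intro powr_mono2) auto
          then show "?b \<alpha> \<le> Vw R \<alpha> (norm x)"
            using x \<alpha> R0 R_lt by (simp add: Vw_def field_simps)
        qed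
      qed
      show "(?b \<longlongrightarrow> exp (- (1 / R))) at_top"
        using tendsto_exp_limit_at_top[of "- 1 / R"] by simp
      \<comment> \<open>On the ball of radius 1/\<alpha> about 0 the weight is at least (1 -
        1/(\<alpha> R))^\<alpha>, with limit exp(-1/R). This costs only exp(2/(R(p+1))), so the 4 in
        the hypothesis leaves slack here.\<close>
      have "exp (- (1 / R)) powr (- 2 / (p + 1)) \<le> exp (4 / (R * (p + 1)))"
      proof -
        have "2 / (R * (p + 1)) \<le> 4 / (R * (p + 1))"
          using R0 p_gt by (intro divide_right_mono) auto
        then show ?thesis unfolding expo by simp
      qed
      then have "R powr ?e * exp (- (1 / R)) powr (- 2 / (p + 1)) \<le> R powr ?e * exp (4 / (R * (p + 1)))"
        by (rule mult_left_mono) simp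
      also have "\<dots> < ?RHS" using R_cond True by (simp add: min_def)
      finally show "R powr ?e * exp (- (1 / R)) powr (- 2 / (p + 1)) < ?RHS" .
    qed simp
  next
    case False
    obtain i :: 'n where True by blast
    \<comment> \<open>The ball of radius 1/\<alpha> about this centre touches the unit sphere, and
      its points have norm above 1 - 2/\<alpha>. The diameter 2/\<alpha> leads to the limit
      exp(-2/(1-R)) for the weight, and its power -2/(p+1) is exactly the exponential with 4 in the
      hypothesis.\<close>
    let ?c = "\<lambda>\<alpha>. (1 - 1 / \<alpha>) *\<^sub>R (axis i 1 :: real^'n)"
    let ?b = "\<lambda>\<alpha>. (1 + (- 2 / (1 - R)) / \<alpha>) powr \<alpha>"
    have nc: "norm (?c \<alpha>) = 1 - 1 / \<alpha>" if "\<alpha> > 1" for \<alpha>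
      using that by (simp add: norm_axis_1)
    show ?thesis
    proof (rule eventually_S_alpha_less_S_alpha_rad[OF N3 p_gt R_ge R_lt a S, of ?c ?b "exp (- (2 / (1 - R)))"])
      show "\<forall>\<^sub>F \<alpha> in at_top. ball (?c \<alpha>) (1 / \<alpha>) \<subseteq> unit_ball"
        using eventually_gt_at_top[of 1]
      proof eventually_elim
        case (elim \<alpha>)
        show ?case
        proof
          fix x assume "x \<in> ball (?c \<alpha>) (1 / \<alpha>)"
          then have "norm (?c \<alpha> - x) < 1 / \<alpha>" by (simp only: mem_ball dist_norm)
          then show "x \<in> unit_ball"
            using norm_triangle_ineq2[of x "?c \<alpha>"] nc[OF elim] by (simp add: unit_ball_def norm_minus_commute)
        qed
      qed
      show "\<forall>\<^sub>F \<alpha> in at_top. \<forall>x\<in>ball (?c \<alpha>) (1 / \<alpha>). ?b \<alpha> \<le> Vw R \<alpha> (norm x)"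
        using eventually_gt_at_top[of "2 / (1 - R)"] eventually_gt_at_top[of 1]
      proof eventually_elim
        case (elim \<alpha>)
        have \<alpha>: "2 / \<alpha> < 1 - R" using elim R_lt by (simp add: field_simps)
        show ?case
        proof
          fix x assume "x \<in> ball (?c \<alpha>) (1 / \<alpha>)"
          then have "norm (?c \<alpha> - x) < 1 / \<alpha>" by (simp only: mem_ball dist_norm)
          then have x: "norm x > 1 - 2 / \<alpha>"
            using norm_triangle_ineq2[of "?c \<alpha>" x] nc[OF elim(2)] by simp
          have xR: "norm x > R" using x \<alpha> by linarith
          have "(1 - norm x) / (1 - R) \<le> (2 / \<alpha>) / (1 - R)"
            using x R_lt by (intro divide_right_mono) auto
          then have "1 - 2 / \<alpha> / (1 - R) \<le> 1 - (1 - norm x) / (1 - R)" by simp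
          moreover have "0 \<le> 1 - 2 / \<alpha> / (1 - R)"
            unfolding diff_ge_0_iff_ge using \<alpha> R_lt by (subst divide_le_eq_1_pos) auto
          ultimately have "(1 - 2 / \<alpha> / (1 - R)) powr \<alpha> \<le> (1 - (1 - norm x) / (1 - R)) powr \<alpha>"
            using elim by (intro powr_mono2) auto
          moreover have "Vw R \<alpha> (norm x) = (1 - (1 - norm x) / (1 - R)) powr \<alpha>"
            using xR R_lt by (auto simp: Vw_def)
          moreover have "1 + (- 2 / (1 - R)) / \<alpha> = 1 - 2 / \<alpha> / (1 - R)" by simp
          ultimately show "?b \<alpha> \<le> Vw R \<alpha> (norm x)" by (simp only:)
        qed
      qed
      show "(?b \<longlongrightarrow> exp (- (2 / (1 - R)))) at_top"
        using tendsto_exp_limit_at_top[of "- 2 / (1 - R)"] by simp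
      have "exp (- (2 / (1 - R))) powr (- 2 / (p + 1)) = exp (4 / ((1 - R) * (p + 1)))"
        unfolding expo by simp
      then show "R powr ?e * exp (- (2 / (1 - R))) powr (- 2 / (p + 1)) < ?RHS"
        using R_cond False by (auto simp: min_def split: if_splits)
    qed simp
  qed
  then obtain \<alpha>1 where \<alpha>1: "\<And>\<alpha>. \<alpha> \<ge> \<alpha>1 \<Longrightarrow> S_alpha TYPE('n) p R \<alpha> < S_alpha_rad TYPE('n) p R \<alpha>"
    by (auto simp: eventually_at_top_linorder)
  show ?thesis
  proof (intro exI[of _ "max 1 \<alpha>1"] conjI allI impI)
    fix \<alpha> assume "\<alpha> > max 1 \<alpha>1"
    then show less: "S_alpha TYPE('n) p R \<alpha> < S_alpha_rad TYPE('n) p R \<alpha>" by (intro \<alpha>1) simp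
    fix u :: "real^'n \<Rightarrow> real" assume "groundstate p R \<alpha> u"
    then show "\<not> radial_fun u" by (rule groundstate_not_radial[OF S less])
  qed simp
qed

end
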